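(* Let $u_1,u_2:\mathbb{R}^2\to\mathbb{R}$ be two non-constant classical solutions of $-\Delta u=u-u^3$ in $\mathbb{R}^2$ such that $u_1(x)<u_2(x)$ for all $x\in\mathbb{R}^2$. Then $u_1$ and $u_2$ are one-dimensional: there exist a unit vector $e\in\mathbb{R}^2$ and real numbers $a<b$ such that $u_1(x)=H(x\cdot e+a)$ and $u_2(x)=H(x\cdot e+b)$ for all $x\in\mathbb{R}^2$, where $H(t)=\tanh(t/\sqrt{2})$.
   Context: Solutions are real-valued and understood in the classical ($C^2$) sense on all of $\mathbb{R}^2$. *)

theory Defs
  imports "HOL-Analysis.Analysis"
begin

definition partial :: "'n \<Rightarrow> (real ^ 'n \<Rightarrow> real) \<Rightarrow> real ^ 'n \<Rightarrow> real" where
  "partial i f x = frechet_derivative f (at x) (axis i 1)"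

(* Continuity of f and of its first partial derivatives follows from their differentiability. *)
definition C2 :: "(real ^ 'n \<Rightarrow> real) \<Rightarrow> bool" where
  "C2 f \<longleftrightarrow>
     f differentiable_on UNIV \<and>
     (\<forall>i. partial i f differentiable_on UNIV) \<and>
     (\<forall>i j. continuous_on UNIV (partial j (partial i f)))"

definition laplacian :: "(real ^ 'n \<Rightarrow> real) \<Rightarrow> real ^ 'n \<Rightarrow> real" where
  "laplacian f x = (\<Sum>i\<in>UNIV. partial i (partial i f) x)"

definition allen_cahn_classical_solution :: "(real ^ 'n \<Rightarrow> real) \<Rightarrow> bool" where
  "allen_cahn_classical_solution u \<longleftrightarrow> C2 u \<and> (\<forall>x. - laplacian u x = u x - u x ^ 3)"

definition H :: "real \<Rightarrow> real" where
  "H t = tanh (t / sqrt 2)"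

end

theory Submission
  imports Defs
begin

text \<open>
  By a Keller--Osserman argument \<open>\<bar>u\<bar> \<le> 1\<close>. For \<open>c > 1\<close> let \<open>g = h\<^sup>-\<^sup>1 \<circ> u\<close> with \<open>h t = c tanh (c t / sqrt 2)\<close>.
  At a maximum of \<open>g x - g y - \<bar>x - y\<bar>\<close> (made to exist by a small penalty) translating both points
  together gives \<open>\<Delta>g x \<le> \<Delta>g y\<close>, while the equation for \<open>g\<close> makes \<open>\<Delta>g\<close> at gradients of length one
  strictly increasing in \<open>u\<close>; hence \<open>g\<close> is 1-Lipschitz. Letting \<open>c \<rightarrow> 1\<close> yields both the strong
  maximum principle \<open>\<bar>u\<bar> < 1\<close> and Modica's inequality \<open>\<bar>\<nabla>g\<bar> \<le> 1\<close> for \<open>u = H \<circ> g\<close>.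

  For two ordered solutions put \<open>d = g\<^sub>2 - g\<^sub>1 > 0\<close> and \<open>\<rho> = (1 - u\<^sub>1\<^sup>2) (1 - u\<^sub>2\<^sup>2) \<le> 1\<close>. Then
  \<open>div (\<rho> \<nabla>d) = - sqrt 2 \<rho> (u\<^sub>2 - u\<^sub>1) (1 - \<nabla>g\<^sub>1 \<bullet> \<nabla>g\<^sub>2) \<le> 0\<close>, so \<open>Y = \<rho> \<nabla>d / d\<close> satisfies
  \<open>div Y + \<bar>Y\<bar>\<^sup>2 \<le> 0\<close> on the plane, which forces \<open>Y = 0\<close> because planar cutoffs have bounded Dirichlet
  energy. Thus \<open>d\<close> is constant, \<open>\<bar>\<nabla>g\<^sub>1\<bar> = 1\<close> and \<open>\<Delta>g\<^sub>1 = 0\<close>, so the Hessian of \<open>g\<^sub>1\<close> vanishes and \<open>g\<^sub>1\<close> is affine.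
\<close>
subsection \<open>Calculus with partial derivatives\<close>

lemma partial_eq:
  assumes "(f has_derivative f') (at x)"
  shows "partial i f x = f' (axis i 1)"
  using frechet_derivative_at[OF assms] by (simp add: partial_def)

lemma differentiable_has_gradient:
  fixes f :: "real ^ 'n \<Rightarrow> real"
  assumes "f differentiable (at x)"
  shows "(f has_derivative (\<lambda>h. \<Sum>i\<in>UNIV. partial i f x * h $ i)) (at x)"
proof -
  let ?D = "frechet_derivative f (at x)"
  have D: "(f has_derivative ?D) (at x)"
    using assms frechet_derivative_works by blast
  interpret bounded_linear ?D
    using D by (rule has_derivative_bounded_linear)
  have "?D h = (\<Sum>i\<in>UNIV. partial i f x * h $ i)" for h
  proof -
    have "?D h = ?D (\<Sum>i\<in>UNIV. h $ i *\<^sub>R axis i 1)"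
      by (simp add: basis_expansion scalar_mult_eq_scaleR[symmetric])
    also have "\<dots> = (\<Sum>i\<in>UNIV. h $ i * ?D (axis i 1))"
      by (simp add: sum scaleR)
    finally show ?thesis
      by (simp add: partial_def mult.commute)
  qed
  then show ?thesis
    using D by (metis (no_types, lifting) ext)
qed

lemma has_real_derivative_line:
  fixes f :: "real ^ 'n \<Rightarrow> real"
  assumes "f differentiable (at (x + t *\<^sub>R axis i 1))"
  shows "((\<lambda>s. f (x + s *\<^sub>R axis i 1)) has_real_derivative partial i f (x + t *\<^sub>R axis i 1)) (at t)"
proof -
  have D: "(f has_derivative frechet_derivative f (at (x + t *\<^sub>R axis i 1))) (at (x + t *\<^sub>R axis i 1))"
    using assms frechet_derivative_works by blast
  have "((\<lambda>s. x + s *\<^sub>R axis i 1) has_derivative (\<lambda>h. h *\<^sub>R axis i 1)) (at t)"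
    by (auto intro!: derivative_eq_intros)
  from has_derivative_compose[OF this, of f, OF D]
  have "((\<lambda>s. f (x + s *\<^sub>R axis i 1)) has_derivative
      (\<lambda>h. frechet_derivative f (at (x + t *\<^sub>R axis i 1)) (h *\<^sub>R axis i 1))) (at t)" .
  then show ?thesis
    using has_derivative_bounded_linear[OF D]
    by (simp add: has_field_derivative_def partial_def bounded_linear.linear linear_scale mult_commute_abs)
qed

text \<open>If \<open>D\<close> were positive, \<open>f'\<close> would be positive just to the right
  of \<open>x\<close> and the mean value theorem would push \<open>f\<close> above its maximum. The
  hypotheses are local because the barrier \<open>M / S t\<close> met below is differentiated only
  where \<open>S t > 0\<close>.\<close>

lemma second_derivative_test_max:
  fixes f f' :: "real \<Rightarrow> real"
  assumes f: "\<forall>\<^sub>F t in nhds x. (f has_real_derivative f' t) (at t)"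
    and f': "(f' has_real_derivative D) (at x)"
    and max: "\<forall>\<^sub>F t in nhds x. f t \<le> f x"
  shows "f' x = 0" and "D \<le> 0"
proof -
  obtain e where e: "e > 0" "\<And>t. \<bar>t - x\<bar> < e \<Longrightarrow> (f has_real_derivative f' t) (at t) \<and> f t \<le> f x"
    using eventually_conj[OF f max] unfolding eventually_nhds_metric dist_real_def by auto
  show f'0: "f' x = 0"
    using DERIV_local_max[of f "f' x" x e] e by (simp add: abs_minus_commute)
  show "D \<le> 0"
  proof (rule ccontr)
    assume "\<not> D \<le> 0"
    then obtain d where d: "d > 0" "\<And>h. 0 < h \<Longrightarrow> h < d \<Longrightarrow> f' x < f' (x + h)"
      using DERIV_pos_inc_right[OF f'] by auto
    define h where "h = min d e / 2"
    have h: "0 < h" "h < d" "h < e"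
      using d e by (auto simp: h_def)
    obtain z where z: "x < z" "z < x + h" "f (x + h) - f x = (x + h - x) * f' z"
      using MVT2[of x "x + h" f f'] h e(2) by auto
    have "f' z > 0"
      using d(2)[of "z - x"] z h f'0 by simp
    then have "f (x + h) > f x"
      using z h by (metis add_diff_cancel_left' diff_gt_0_iff_gt mult_pos_pos)
    then show False
      using e(2)[of "x + h"] h by simp
  qed
qed

lemma norm_line_power2:
  fixes a :: "real ^ 'n"
  shows "(norm (a + t *\<^sub>R axis i 1))\<^sup>2 = (norm a)\<^sup>2 + 2 * t * a $ i + t\<^sup>2"
  unfolding power2_norm_eq_inner
  by (simp add: inner_add inner_axis inner_axis' inner_axis_axis algebra_simps power2_eq_square)

lemma norm_power2_sum: "(norm a)\<^sup>2 = (\<Sum>i\<in>UNIV. (a $ i)\<^sup>2)" for a :: "real ^ 'n"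
  by (simp add: norm_vec_def L2_set_def sum_nonneg)

lemma C2_differentiable:
  assumes "C2 f"
  shows "f differentiable (at x)" "partial i f differentiable (at x)"
  using assms by (auto simp: C2_def differentiable_on_def)

lemma C2_continuous:
  assumes "C2 f"
  shows "continuous_on S f" "continuous_on S (partial i f)" "continuous_on S (partial j (partial i f))"
  using assms unfolding C2_def
  by (meson differentiable_imp_continuous_on continuous_on_subset subset_UNIV)+

text \<open>Derivatives of \<open>\<phi>\<close> are asked for only at values of \<open>f\<close>,
  so that the rule applies to \<open>layer_inv c\<close>, whose derivative is known only inside (-c,
  c).\<close>

lemma C2_compose:
  fixes f :: "real ^ 'n \<Rightarrow> real"
  assumes f: "C2 f"
    and \<phi>: "\<And>x. (\<phi> has_real_derivative \<phi>' (f x)) (at (f x))"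
    and \<phi>': "\<And>x. (\<phi>' has_real_derivative \<phi>'' (f x)) (at (f x))"
    and \<phi>'': "continuous_on (range f) \<phi>''"
  shows "C2 (\<lambda>x. \<phi> (f x))"
    and "partial i (\<lambda>x. \<phi> (f x)) = (\<lambda>x. \<phi>' (f x) * partial i f x)"
    and "partial j (partial i (\<lambda>x. \<phi> (f x))) =
      (\<lambda>x. \<phi>'' (f x) * partial j f x * partial i f x + \<phi>' (f x) * partial j (partial i f) x)"
proof -
  note d = differentiable_has_gradient[OF C2_differentiable(1)[OF f]]
    differentiable_has_gradient[OF C2_differentiable(2)[OF f]]
  note diff = C2_differentiable[OF f]
  have D: "((\<lambda>x. \<phi> (f x)) has_derivative (\<lambda>h. \<phi>' (f x) * (\<Sum>i\<in>UNIV. partial i f x * h $ i))) (at x)" for x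
    using has_derivative_compose[OF d(1) \<phi>[unfolded has_field_derivative_def]] .
  have D': "((\<lambda>x. \<phi>' (f x)) has_derivative (\<lambda>h. \<phi>'' (f x) * (\<Sum>i\<in>UNIV. partial i f x * h $ i))) (at x)" for x
    using has_derivative_compose[OF d(1) \<phi>'[unfolded has_field_derivative_def]] .
  show 1: "partial i (\<lambda>x. \<phi> (f x)) = (\<lambda>x. \<phi>' (f x) * partial i f x)" for i
    by (rule ext, subst partial_eq[OF D]) (simp add: axis_def if_distrib cong: if_cong)
  have D2: "((\<lambda>x. \<phi>' (f x) * partial i f x) has_derivative
     (\<lambda>h. \<phi>' (f x) * (\<Sum>j\<in>UNIV. partial j (partial i f) x * h $ j)
        + \<phi>'' (f x) * (\<Sum>i\<in>UNIV. partial i f x * h $ i) * partial i f x)) (at x)" for i x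
    using has_derivative_mult[OF D' d(2)] by simp
  show 2: "partial j (partial i (\<lambda>x. \<phi> (f x))) =
      (\<lambda>x. \<phi>'' (f x) * partial j f x * partial i f x + \<phi>' (f x) * partial j (partial i f) x)" for i j
    unfolding 1 by (rule ext, subst partial_eq[OF D2]) (simp add: axis_def if_distrib cong: if_cong)
  have c1: "continuous_on UNIV (\<lambda>x. \<phi>' (f x))"
    by (intro continuous_at_imp_continuous_on ballI has_derivative_continuous[OF D'])
  have c2: "continuous_on UNIV (\<lambda>x. \<phi>'' (f x))"
    using continuous_on_compose2[OF \<phi>'' C2_continuous(1)[OF f]] by blast
  have "(\<lambda>x. \<phi> (f x)) differentiable_on UNIV" "partial i (\<lambda>x. \<phi> (f x)) differentiable_on UNIV" for i
    unfolding 1 differentiable_on_def using differentiableI[OF D] differentiableI[OF D2] by blast+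
  then show "C2 (\<lambda>x. \<phi> (f x))"
    unfolding C2_def 2
    by (intro conjI allI continuous_on_add continuous_on_mult c1 c2 C2_continuous[OF f])
qed

lemma allen_cahn_uminus:
  assumes "allen_cahn_classical_solution u"
  shows "allen_cahn_classical_solution (\<lambda>x. - u x)"
proof -
  have u: "C2 u"
    using assms by (simp add: allen_cahn_classical_solution_def)
  note * = C2_compose[OF u, of uminus "\<lambda>_. -1" "\<lambda>_. 0"]
  have "(uminus has_real_derivative - 1) (at t)" "((\<lambda>_. - 1) has_real_derivative 0) (at t)" for t :: real
    by (auto intro!: derivative_eq_intros)
  note * = C2_compose[OF u this continuous_on_const]
  have "C2 (\<lambda>x. - u x)" "laplacian (\<lambda>x. - u x) x = - laplacian u x" for x
    using * by (simp_all add: laplacian_def sum_negf)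
  with assms show ?thesis
    by (simp add: allen_cahn_classical_solution_def)
qed

lemma allen_cahn_laplacian:
  assumes "allen_cahn_classical_solution u"
  shows "laplacian u x = u x ^ 3 - u x"
  using assms by (simp add: allen_cahn_classical_solution_def) (smt (verit))

subsection \<open>The bound by one\<close>

text \<open>Keller-Osserman in quantitative form: a barrier M / (R^2 - |y - x|^2) touches u - 1 from
  above, and the cubic growth of u^3 - u bounds (u x - 1) R by a constant depending only on the
  dimension. Large R then excludes u x > 1.\<close>

lemma allen_cahn_le_1:
  fixes u :: "real ^ 'n \<Rightarrow> real"
  assumes u: "allen_cahn_classical_solution u"
  shows "u x \<le> 1"
proof -
  have C2: "C2 u"
    using u by (simp add: allen_cahn_classical_solution_def)
  let ?n = "real CARD('n)"
  \<comment> \<open>The two summands come from the two parts of the Laplacian of the barrier, once s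
    and |a|^2 are estimated by R^2.\<close>
  define c where "c = sqrt (2 * ?n + 8)"
  have c: "c \<ge> 0" "c\<^sup>2 = 2 * ?n + 8"
    by (auto simp: c_def)
  have bound: "(u x - 1) * R \<le> c" if R: "R > 0" for R
  proof -
    \<comment> \<open>The weight vanishes on the sphere, so a positive maximum lies in the open
      ball.\<close>
    define F where "F = (\<lambda>y. (u y - 1) * (R\<^sup>2 - (norm (y - x))\<^sup>2))"
    have "continuous_on (cball x R) F"
      unfolding F_def by (intro continuous_intros C2_continuous[OF C2])
    then obtain z where z: "z \<in> cball x R" "\<And>y. y \<in> cball x R \<Longrightarrow> F y \<le> F z"
      using continuous_attains_sup[of "cball x R" F] R by auto
    have Fx: "(u x - 1) * R\<^sup>2 \<le> F z"
      using z(2)[of x] R by (simp add: F_def)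
    show ?thesis
    proof (cases "F z \<le> 0")
      case True
      then have "u x - 1 \<le> 0"
        using Fx R by (meson mult_pos_pos not_le order_less_le_trans zero_less_power)
      then show ?thesis
        using R c(1) by (smt (verit) mult_nonpos_nonneg)
    next
      case False
      define M where "M = F z"
      define a where "a = z - x"
      define s where "s = R\<^sup>2 - (norm a)\<^sup>2"
      have M: "M > 0" "M = (u z - 1) * s"
        using False by (auto simp: M_def F_def s_def a_def)
      have "norm a \<le> R"
        using z(1) by (simp add: a_def dist_norm norm_minus_commute)
      then have "s \<ge> 0"
        using R by (simp add: s_def power_mono)
      with M have s: "s > 0"
        by (cases "s = 0") auto
      have uz: "u z = 1 + M / s"
        using M s by (simp add: field_simps)
      \<comment> \<open>On each axis through \<open>z\<close> the difference of u - 1 and the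
        barrier \<open>M / S\<close> is maximal at \<open>z\<close>; the subtracted term is the
        second derivative of the barrier.\<close>
      have line: "partial i (partial i u) z - M * (2 / s\<^sup>2 + 8 * (a $ i)\<^sup>2 / s ^ 3) \<le> 0" for i
      proof -
        define S where "S = (\<lambda>t. s - 2 * t * a $ i - t\<^sup>2)"
        have S: "R\<^sup>2 - (norm (z + t *\<^sub>R axis i 1 - x))\<^sup>2 = S t" for t
          using norm_line_power2[of a t i] by (simp add: S_def s_def a_def algebra_simps)
        have S0: "S 0 = s" by (simp add: S_def)
        have "isCont S 0"
          unfolding S_def by (intro continuous_intros)
        then have ev: "\<forall>\<^sub>F t in nhds 0. S t > 0"
          using s S0 by (metis continuous_within eventually_nhds_conv_at order_tendstoD(1) UNIV_I)
        have dS: "(S has_real_derivative - 2 * a $ i - 2 * t) (at t)" for t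
          unfolding S_def by (auto intro!: derivative_eq_intros)
        show ?thesis
        proof (rule second_derivative_test_max(2)[where x = 0
              and f = "\<lambda>t. u (z + t *\<^sub>R axis i 1) - M / S t"
              and f' = "\<lambda>t. partial i u (z + t *\<^sub>R axis i 1) + M * (- 2 * a $ i - 2 * t) / (S t)\<^sup>2"])
          show "\<forall>\<^sub>F t in nhds 0. ((\<lambda>t. u (z + t *\<^sub>R axis i 1) - M / S t) has_real_derivative
            partial i u (z + t *\<^sub>R axis i 1) + M * (- 2 * a $ i - 2 * t) / (S t)\<^sup>2) (at t)"
            using ev
          proof eventually_elim
            case (elim t)
            then show ?case
              by (auto intro!: derivative_eq_intros dS has_real_derivative_line C2_differentiable[OF C2]
                  simp: power2_eq_square)
          qed
          have "((\<lambda>t. partial i u (z + t *\<^sub>R axis i 1) + M * (- 2 * a $ i - 2 * t) / (S t)\<^sup>2) has_real_derivative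
             partial i (partial i u) (z + 0 *\<^sub>R axis i 1) +
             (M * (-2) * s\<^sup>2 - M * (- 2 * a $ i) * (2 * s * (- 2 * a $ i))) / (s\<^sup>2 * s\<^sup>2)) (at 0)"
            using s S0
            by (auto intro!: derivative_eq_intros dS has_real_derivative_line C2_differentiable[OF C2])
          also have "(M * (-2) * s\<^sup>2 - M * (- 2 * a $ i) * (2 * s * (- 2 * a $ i))) / (s\<^sup>2 * s\<^sup>2)
            = - M * (2 / s\<^sup>2 + 8 * (a $ i)\<^sup>2 / s ^ 3)"
            using s by (simp add: field_simps) algebra
          finally show "((\<lambda>t. partial i u (z + t *\<^sub>R axis i 1) + M * (- 2 * a $ i - 2 * t) / (S t)\<^sup>2) has_real_derivative
             partial i (partial i u) z - M * (2 / s\<^sup>2 + 8 * (a $ i)\<^sup>2 / s ^ 3)) (at 0)"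
            by simp
          show "\<forall>\<^sub>F t in nhds 0. u (z + t *\<^sub>R axis i 1) - M / S t \<le> u (z + 0 *\<^sub>R axis i 1) - M / S 0"
            using ev
          proof eventually_elim
            case (elim t)
            then have "(norm (z + t *\<^sub>R axis i 1 - x))\<^sup>2 \<le> R\<^sup>2"
              using S[of t] by simp
            then have "z + t *\<^sub>R axis i 1 \<in> cball x R"
              using R by (simp add: dist_norm norm_minus_commute power2_le_iff_abs_le)
            from z(2)[OF this] have "(u (z + t *\<^sub>R axis i 1) - 1) * S t \<le> M"
              by (simp add: F_def M_def S)
            then have "u (z + t *\<^sub>R axis i 1) - 1 \<le> M / S t"
              using elim by (simp add: pos_le_divide_eq)
            then show ?case
              using uz S0 by simp
          qed
        qed
      qed
      have "laplacian u z \<le> (\<Sum>i\<in>UNIV. M * (2 / s\<^sup>2 + 8 * (a $ i)\<^sup>2 / s ^ 3))"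
        unfolding laplacian_def by (intro sum_mono) (use line in \<open>simp add: algebra_simps\<close>)
      also have "\<dots> = M * (2 * ?n / s\<^sup>2 + 8 * (norm a)\<^sup>2 / s ^ 3)"
        unfolding norm_power2_sum
        by (simp add: sum_distrib_left sum_divide_distrib sum.distrib algebra_simps)
      also have "\<dots> = M * (2 * ?n * s + 8 * (norm a)\<^sup>2) / s ^ 3"
        using s by (simp add: field_simps power2_eq_square power3_eq_cube)
      finally have le: "laplacian u z \<le> M * (2 * ?n * s + 8 * (norm a)\<^sup>2) / s ^ 3" .
      have "laplacian u z = u z ^ 3 - u z"
        using allen_cahn_laplacian[OF u] .
      \<comment> \<open>All terms of the expansion of u^3 - u around 1 are positive; the cube alone
        suffices.\<close>
      also have "\<dots> = (M / s) ^ 3 + 3 * (M / s)\<^sup>2 + 2 * (M / s)"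
        unfolding uz by algebra
      also have "\<dots> \<ge> (M / s) ^ 3"
        using divide_pos_pos[OF M(1) s] by (smt (verit) zero_le_power2)
      finally have "M ^ 3 / s ^ 3 \<le> M * (2 * ?n * s + 8 * (norm a)\<^sup>2) / s ^ 3"
        using le by (simp add: power_divide)
      then have "M ^ 3 \<le> M * (2 * ?n * s + 8 * (norm a)\<^sup>2)"
        using s by (simp add: divide_le_cancel)
      then have "M\<^sup>2 \<le> 2 * ?n * s + 8 * (norm a)\<^sup>2"
        by (simp only: power3_eq_cube power2_eq_square mult.assoc mult_le_cancel_left_pos[OF M(1)])
      also have "\<dots> \<le> 2 * ?n * R\<^sup>2 + 8 * R\<^sup>2"
        using s by (intro add_mono mult_left_mono) (auto simp: s_def)
      also have "\<dots> = (c * R)\<^sup>2"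
        by (simp only: c(2) power_mult_distrib distrib_right)
      finally have "M \<le> c * R"
        by (rule power2_le_imp_le) (use c(1) R in simp)
      then have "(u x - 1) * R * R \<le> c * R"
        using Fx by (simp add: M_def power2_eq_square mult.assoc)
      then show ?thesis
        using R by simp
    qed
  qed
  show ?thesis
  proof (rule ccontr)
    assume "\<not> u x \<le> 1"
    \<comment> \<open>The chosen radius makes the product in \<open>bound\<close> equal to c +
      1.\<close>
    then show False
      using bound[of "(c + 1) / (u x - 1)"] c by (simp add: field_simps)
  qed
qed

lemma allen_cahn_abs_le_1:
  assumes "allen_cahn_classical_solution u"
  shows "\<bar>u x\<bar> \<le> 1"
  using allen_cahn_le_1[OF assms, of x] allen_cahn_le_1[OF allen_cahn_uminus[OF assms], of x]
  by (simp add: abs_le_iff)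

subsection \<open>The gradient bound\<close>

text \<open>The inverse of \<open>t \<mapsto> c tanh (c t / sqrt 2)\<close>, which solves \<open>h'' = h\<^sup>3 - c\<^sup>2 h\<close>.\<close>

definition layer_inv :: "real \<Rightarrow> real \<Rightarrow> real" where
  "layer_inv c s = (ln (c + s) - ln (c - s)) / (sqrt 2 * c)"

lemma square_less_if_abs_less: "s\<^sup>2 < c\<^sup>2" if "\<bar>s\<bar> < c" for s c :: real
  using that by (metis abs_ge_zero power2_abs power_strict_mono zero_less_numeral)

lemma layer_inv_deriv:
  assumes "\<bar>s\<bar> < c"
  shows "(layer_inv c has_real_derivative sqrt 2 / (c\<^sup>2 - s\<^sup>2)) (at s)"
proof -
  have c: "c + s > 0" "c - s > 0" "c > 0"
    using assms by auto
  have "(layer_inv c has_real_derivative (1 / (c + s) + 1 / (c - s)) / (sqrt 2 * c)) (at s)"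
    unfolding layer_inv_def[abs_def] using c by (auto intro!: derivative_eq_intros)
  also have "(1 / (c + s) + 1 / (c - s)) / (sqrt 2 * c) = (2 / sqrt 2) / ((c + s) * (c - s))"
    using c by (simp add: divide_simps)
  also have "\<dots> = sqrt 2 / (c\<^sup>2 - s\<^sup>2)"
    by (simp add: real_div_sqrt power2_eq_square algebra_simps)
  finally show ?thesis .
qed

lemma layer_inv_deriv2:
  assumes "\<bar>s\<bar> < c"
  shows "((\<lambda>s. sqrt 2 / (c\<^sup>2 - s\<^sup>2)) has_real_derivative 2 * sqrt 2 * s / (c\<^sup>2 - s\<^sup>2)\<^sup>2) (at s)"
  using square_less_if_abs_less[OF assms]
  by (auto intro!: derivative_eq_intros simp: power2_eq_square)

lemma layer_inv_mono:
  assumes "s \<le> t" "\<bar>s\<bar> < c" "\<bar>t\<bar> < c"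
  shows "layer_inv c s \<le> layer_inv c t"
proof -
  have "ln (c + s) \<le> ln (c + t)" "ln (c - t) \<le> ln (c - s)"
    using assms by auto
  then have "ln (c + s) - ln (c - s) \<le> ln (c + t) - ln (c - t)"
    by linarith
  then show ?thesis
    unfolding layer_inv_def by (rule divide_right_mono) (use assms in auto)
qed

lemma H_layer_inv:
  assumes "\<bar>s\<bar> < 1"
  shows "H (layer_inv 1 s) = s"
proof -
  have s: "1 + s > 0" "1 - s > 0"
    using assms by auto
  have "- 2 * (layer_inv 1 s / sqrt 2) = ln (1 - s) - ln (1 + s)"
    by (simp add: layer_inv_def)
  then have "exp (- 2 * (layer_inv 1 s / sqrt 2)) = (1 - s) / (1 + s)"
    using s by (simp add: exp_diff)
  then have "H (layer_inv 1 s) = (1 - (1 - s) / (1 + s)) / (1 + (1 - s) / (1 + s))"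
    by (simp only: H_def tanh_real_altdef)
  moreover have "1 - (1 - s) / (1 + s) = 2 * s / (1 + s)" "1 + (1 - s) / (1 + s) = 2 / (1 + s)"
    using s by (simp_all add: field_simps)
  ultimately show ?thesis
    using s by simp
qed

text \<open>Write u = h(g) with h' = (c^2 - h^2) / sqrt 2 and h'' = h^3 - c^2 h, and solve h'
  \<Delta>g + h'' |\<nabla>g|^2 = u^3 - u for \<Delta>g. The term with the factor
  \<open>c\<^sup>2 - 1\<close> increases strictly in u when c > 1 and disappears when c = 1.\<close>

lemma allen_cahn_layer_inv:
  fixes u :: "real ^ 'n \<Rightarrow> real"
  assumes u: "allen_cahn_classical_solution u" and lt: "\<And>x. \<bar>u x\<bar> < c"
  defines "g \<equiv> \<lambda>x. layer_inv c (u x)"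
  shows "C2 g"
    and "partial i g x = sqrt 2 / (c\<^sup>2 - (u x)\<^sup>2) * partial i u x"
    and "laplacian g x = sqrt 2 * (c\<^sup>2 - 1) * (u x / (c\<^sup>2 - (u x)\<^sup>2))
      + sqrt 2 * u x * ((\<Sum>i\<in>UNIV. (partial i g x)\<^sup>2) - 1)"
proof -
  have C2: "C2 u"
    using u by (simp add: allen_cahn_classical_solution_def)
  have nz: "c\<^sup>2 - (u x)\<^sup>2 > 0" for x
    using square_less_if_abs_less[OF lt, of x] by simp
  have "continuous_on (range u) (\<lambda>s. 2 * sqrt 2 * s / (c\<^sup>2 - s\<^sup>2)\<^sup>2)"
    using nz by (intro continuous_intros) (force simp: less_le)
  note * = C2_compose[OF C2 layer_inv_deriv[OF lt] layer_inv_deriv2[OF lt] this]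
  show "C2 g"
    unfolding g_def by (rule *(1))
  show pg: "partial i g x = sqrt 2 / (c\<^sup>2 - (u x)\<^sup>2) * partial i u x" for i x
    unfolding g_def *(2) ..
  define T where "T = c\<^sup>2 - (u x)\<^sup>2"
  define N where "N = (\<Sum>i\<in>UNIV. (partial i u x)\<^sup>2)"
  have T: "T > 0"
    using nz by (simp add: T_def)
  have N: "(\<Sum>i\<in>UNIV. (partial i g x)\<^sup>2) = 2 / T\<^sup>2 * N"
    unfolding pg N_def sum_distrib_left T_def[symmetric]
    by (simp add: power_mult_distrib power_divide)
  have "laplacian g x = 2 * sqrt 2 * u x / T\<^sup>2 * N + sqrt 2 / T * laplacian u x"
    unfolding laplacian_def g_def *(3) T_def[symmetric] N_def
    by (simp add: sum.distrib sum_distrib_left power2_eq_square mult.assoc)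
  also have "\<dots> = sqrt 2 * u x * (2 / T\<^sup>2 * N) + sqrt 2 * u x * (((u x)\<^sup>2 - 1) / T)"
  proof -
    have "u x ^ 3 - u x = u x * ((u x)\<^sup>2 - 1)"
      by algebra
    then show ?thesis
      unfolding allen_cahn_laplacian[OF u] by (simp add: mult_ac)
  qed
  also have "((u x)\<^sup>2 - 1) / T = (c\<^sup>2 - 1) / T - 1"
  proof -
    have "(u x)\<^sup>2 - 1 = (c\<^sup>2 - 1) - T"
      by (simp add: T_def)
    then show ?thesis
      using T by (simp add: diff_divide_distrib)
  qed
  finally show "laplacian g x = sqrt 2 * (c\<^sup>2 - 1) * (u x / (c\<^sup>2 - (u x)\<^sup>2))
      + sqrt 2 * u x * ((\<Sum>i\<in>UNIV. (partial i g x)\<^sup>2) - 1)"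
    unfolding N T_def[symmetric] by (simp add: algebra_simps diff_divide_distrib)
qed

section \<open>The Lipschitz bound by doubling of variables\<close>

lemma continuous_attains_sup_coercive:
  fixes F :: "'a::{heine_borel,real_normed_vector} \<Rightarrow> real"
  assumes "continuous_on UNIV F" and "F p > 0" and "\<And>q. F q > 0 \<Longrightarrow> norm q \<le> r"
  obtains q where "F q > 0" "\<And>q'. F q' \<le> F q"
proof -
  have p: "p \<in> cball 0 r"
    using assms by auto
  obtain q where q: "q \<in> cball 0 r" "\<And>q'. q' \<in> cball 0 r \<Longrightarrow> F q' \<le> F q"
    using continuous_attains_sup[OF compact_cball _ continuous_on_subset[OF assms(1) subset_UNIV]] p
    by (metis empty_iff)
  have "F q > 0"
    using q(2)[OF p] assms(2) by simp
  moreover have "F q' \<le> F q" for q'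
    using q(2)[of q'] assms(3)[of q'] \<open>F q > 0\<close> by (cases "F q' > 0") auto
  ultimately show ?thesis ..
qed

lemma sqrt_quadratic_deriv:
  fixes b :: real
  assumes "A + 2 * t * b + t\<^sup>2 > 0"
  shows "((\<lambda>t. sqrt (A + 2 * t * b + t\<^sup>2)) has_real_derivative (b + t) / sqrt (A + 2 * t * b + t\<^sup>2)) (at t)"
  using assms by (auto intro!: derivative_eq_intros simp: field_simps)

text \<open>Half of a supposed excess Z survives at a penalised maximum (X, Y). Both gradients of g
  have length close to one there, so the monotone term forces the Laplacians apart by at least
  \<kappa> - 6 \<epsilon>, whereas translations allow at most n \<epsilon>.\<close>

lemma allen_cahn_layer_inv_lipschitz:
  fixes u :: "real ^ 'n \<Rightarrow> real"
  assumes u: "allen_cahn_classical_solution u" and c: "c > 1"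
  shows "layer_inv c (u x) - layer_inv c (u y) \<le> norm (x - y)"
proof (rule ccontr)
  assume neg: "\<not> ?thesis"
  have u1: "\<bar>u x\<bar> \<le> 1" for x
    by (rule allen_cahn_abs_le_1[OF u])
  have uc: "\<bar>u x\<bar> < c" for x
    using u1[of x] c by linarith
  define g where "g = (\<lambda>x. layer_inv c (u x))"
  note g = allen_cahn_layer_inv[OF u uc, folded g_def]
  note gd = C2_differentiable[OF g(1)]
  let ?n = "real CARD('n)"
  define Z where "Z = g x - g y - norm (x - y)"
  have Z: "Z > 0"
    using neg by (simp add: Z_def g_def)
  \<comment> \<open>A smooth substitute for the norm: its gradient has length at most one and its
    pure second derivatives are at most one.\<close>
  define p where "p = (\<lambda>x :: real ^ 'n. sqrt (1 + (norm x)\<^sup>2))"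
  have p1: "p x \<ge> 1" and px: "p x \<ge> norm x" for x
    by (auto simp: p_def intro: real_le_rsqrt)
  \<comment> \<open>Product of the coefficient sqrt 2 (c^2 - 1) of the monotone term, a lower bound
    (c^2 - 1) / c^4 for its slope, and the least gap (c^2 - 1) / sqrt 2 * (Z / 2) between u X and u
    Y.\<close>
  define \<kappa> where "\<kappa> = (c\<^sup>2 - 1) ^ 3 / c ^ 4 * (Z / 2)"
  have c2: "c\<^sup>2 > 1"
    using c by (simp add: power_gt1_lemma power2_eq_square) (metis less_1_mult)
  have \<kappa>: "\<kappa> > 0"
    using Z c c2 by (simp add: \<kappa>_def)
  \<comment> \<open>The penalty at the point \<open>x\<close> may cost half of Z; in n + 6, n pays
    for the Laplacian of the penalty and 6 for the gradient error. The bound by one gives |w| + 1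
    \<le> 3 below.\<close>
  define \<epsilon> where "\<epsilon> = min 1 (min (Z / (2 * p x)) (\<kappa> / (2 * (?n + 6))))"
  have \<epsilon>: "\<epsilon> > 0" "\<epsilon> \<le> 1" "\<epsilon> * p x \<le> Z / 2" "\<epsilon> * (?n + 6) \<le> \<kappa> / 2"
  proof -
    have px0: "p x > 0"
      using p1[of x] by linarith
    have n0: "?n + 6 > 0"
      by simp
    show "\<epsilon> > 0" "\<epsilon> \<le> 1"
      using Z px0 \<kappa> by (auto simp: \<epsilon>_def)
    have "\<epsilon> \<le> (Z / 2) / p x" "\<epsilon> \<le> (\<kappa> / 2) / (?n + 6)"
      by (simp_all add: \<epsilon>_def)
    then show "\<epsilon> * p x \<le> Z / 2" "\<epsilon> * (?n + 6) \<le> \<kappa> / 2"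
      using px0 n0 by (simp_all only: pos_le_divide_eq)
  qed
  define F where "F = (\<lambda>q. g (fst q) - g (snd q) - norm (fst q - snd q) - \<epsilon> * p (fst q))"
  define B where "B = layer_inv c 1"
  have gB: "g x \<le> B" "- B \<le> g x" for x
  proof -
    have "layer_inv c (- 1) = - B"
      by (simp add: B_def layer_inv_def minus_divide_left add.commute)
    then show "g x \<le> B" "- B \<le> g x"
      using layer_inv_mono[of "u x" 1 c] layer_inv_mono[of "- 1" "u x" c] u1[of x] uc[of x] c
      by (auto simp: g_def B_def)
  qed
  \<comment> \<open>Penalising the first point alone is enough, since g is bounded and the term
    \<open>norm (a - b)\<close> keeps the second point near the first.\<close>
  obtain q where q: "F q > 0" "\<And>q'. F q' \<le> F q"
  proof (rule continuous_attains_sup_coercive)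
    show "continuous_on UNIV F"
      unfolding F_def p_def
      by (intro continuous_intros continuous_on_compose2[OF C2_continuous(1)[OF g(1)]]) auto
    show "F (x, y) > 0"
      using Z \<epsilon>(3) by (simp add: F_def Z_def)
    show "norm q \<le> 2 * (2 * B / \<epsilon>) + 2 * B" if "F q > 0" for q
    proof -
      obtain a b where q: "q = (a, b)"
        by (cases q)
      have *: "norm (a - b) + \<epsilon> * p a \<le> 2 * B"
        using that gB[of a] gB[of b] by (simp add: F_def q)
      have "\<epsilon> * norm a \<le> 2 * B"
        using * mult_left_mono[OF px, of \<epsilon> a] \<epsilon>(1) norm_ge_zero[of "a - b"] by linarith
      then have "norm a \<le> 2 * B / \<epsilon>"
        using \<epsilon>(1) by (simp add: pos_le_divide_eq mult.commute)
      moreover have "norm (a - b) \<le> 2 * B"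
        using * mult_nonneg_nonneg[of \<epsilon> "p a"] \<epsilon>(1) p1[of a] by linarith
      moreover have "norm b \<le> norm a + norm (a - b)"
        by (metis norm_minus_commute norm_triangle_sub)
      ultimately show ?thesis
        using norm_Pair_le[of a b] by (simp add: q)
    qed
  qed blast
  obtain X Y where XY: "q = (X, Y)"
    by (cases q)
  have max: "g a - g b - norm (a - b) - \<epsilon> * p a \<le> g X - g Y - norm (X - Y) - \<epsilon> * p X" for a b
    using q(2)[of "(a, b)"] by (simp add: F_def XY)
  have gXY: "g X - g Y \<ge> Z / 2"
    using max[of x y] \<epsilon>(3) mult_nonneg_nonneg[of \<epsilon> "p X"] \<epsilon>(1) p1[of X] norm_ge_zero[of "X - Y"]
    unfolding Z_def by argo
  then have "X \<noteq> Y"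
    using Z by auto
  define v where "v = Y - X"
  have v: "norm v > 0"
    using \<open>X \<noteq> Y\<close> by (simp add: v_def)
  \<comment> \<open>Only Y varies. As X and Y differ, the distance is differentiable there and has a
    gradient of length one.\<close>
  have gY: "partial i g Y = - v $ i / norm v" for i
  proof -
    have "((\<lambda>t. - g (Y + t *\<^sub>R axis i 1) - sqrt ((norm v)\<^sup>2 + 2 * t * v $ i + t\<^sup>2)) has_real_derivative
       - partial i g (Y + 0 *\<^sub>R axis i 1) - (v $ i + 0) / sqrt ((norm v)\<^sup>2 + 2 * 0 * v $ i + 0\<^sup>2)) (at 0)"
      using v by (intro derivative_intros has_real_derivative_line gd sqrt_quadratic_deriv) simp
    moreover have "- g (Y + t *\<^sub>R axis i 1) - sqrt ((norm v)\<^sup>2 + 2 * t * v $ i + t\<^sup>2)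
       \<le> - g (Y + 0 *\<^sub>R axis i 1) - sqrt ((norm v)\<^sup>2 + 2 * 0 * v $ i + 0\<^sup>2)" for t
    proof -
      have "sqrt ((norm v)\<^sup>2 + 2 * t * v $ i + t\<^sup>2) = norm (X - (Y + t *\<^sub>R axis i 1))"
        unfolding norm_line_power2[symmetric]
        by (simp add: v_def norm_minus_commute[of X] algebra_simps)
      moreover have "norm v = norm (X - Y)"
        by (simp add: v_def norm_minus_commute)
      ultimately show ?thesis
        using max[of X "Y + t *\<^sub>R axis i 1"] by simp
    qed
    ultimately have "- partial i g (Y + 0 *\<^sub>R axis i 1) - (v $ i + 0) / sqrt ((norm v)\<^sup>2 + 2 * 0 * v $ i + 0\<^sup>2) = 0"
      by (intro DERIV_local_max[where d = 1]) auto
    then show ?thesis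
      by simp
  qed
  \<comment> \<open>Translating both points by the same vector leaves the distance term unchanged.\<close>
  have trans: "partial i g X - partial i g Y - \<epsilon> * (X $ i / p X) = 0"
    "partial i (partial i g) X - partial i (partial i g) Y \<le> \<epsilon>" for i
  proof -
    define P where "P = (\<lambda>t. sqrt (1 + (norm X)\<^sup>2 + 2 * t * X $ i + t\<^sup>2))"
    have P: "p (X + t *\<^sub>R axis i 1) = P t" for t
      by (simp add: p_def P_def norm_line_power2 add.assoc)
    have P0: "P t > 0" for t
      using P[of t] p1[of "X + t *\<^sub>R axis i 1"] by simp
    have dP: "(P has_real_derivative (X $ i + t) / P t) (at t)" for t
      unfolding P_def using P0[of t] by (intro sqrt_quadratic_deriv) (simp add: P_def)
    have ddP: "((\<lambda>t. (X $ i + t) / P t) has_real_derivative (1 * P t - (X $ i + t) * ((X $ i + t) / P t)) / (P t * P t)) (at t)" for t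
      using P0[of t] by (auto intro!: derivative_eq_intros dP)
    have mx: "g (X + t *\<^sub>R axis i 1) - g (Y + t *\<^sub>R axis i 1) - \<epsilon> * P t
       \<le> g (X + 0 *\<^sub>R axis i 1) - g (Y + 0 *\<^sub>R axis i 1) - \<epsilon> * P 0" for t
      using max[of "X + t *\<^sub>R axis i 1" "Y + t *\<^sub>R axis i 1"] P[of t] P[of 0] by simp
    have d1: "((\<lambda>t. g (X + t *\<^sub>R axis i 1) - g (Y + t *\<^sub>R axis i 1) - \<epsilon> * P t) has_real_derivative
       partial i g (X + t *\<^sub>R axis i 1) - partial i g (Y + t *\<^sub>R axis i 1) - \<epsilon> * ((X $ i + t) / P t)) (at t)" for t
      by (auto intro!: derivative_eq_intros has_real_derivative_line gd dP)
    have d2: "((\<lambda>t. partial i g (X + t *\<^sub>R axis i 1) - partial i g (Y + t *\<^sub>R axis i 1) - \<epsilon> * ((X $ i + t) / P t))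
       has_real_derivative
       partial i (partial i g) (X + 0 *\<^sub>R axis i 1) - partial i (partial i g) (Y + 0 *\<^sub>R axis i 1)
         - \<epsilon> * ((1 * P 0 - (X $ i + 0) * ((X $ i + 0) / P 0)) / (P 0 * P 0))) (at 0)"
      by (intro DERIV_diff DERIV_cmult has_real_derivative_line gd ddP)
    note test = second_derivative_test_max[OF always_eventually[OF allI, OF d1] d2 always_eventually[OF allI, OF mx]]
    show "partial i g X - partial i g Y - \<epsilon> * (X $ i / p X) = 0"
      using test(1) P[of 0] by simp
    have "P 0 \<ge> 1"
      using P[of 0] p1[of X] by simp
    then have "P 0 \<le> P 0 * P 0"
      by simp
    moreover have "(X $ i) * ((X $ i) / P 0) \<ge> 0"
      using P0[of 0] by simp
    ultimately have "P 0 - X $ i * (X $ i / P 0) \<le> P 0 * P 0"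
      by linarith
    then have "(P 0 - X $ i * (X $ i / P 0)) / (P 0 * P 0) \<le> 1"
      using P0[of 0] by (metis divide_le_eq_1_pos mult_pos_pos)
    from mult_left_mono[OF this, of \<epsilon>] \<epsilon>(1) test(2)
    show "partial i (partial i g) X - partial i (partial i g) Y \<le> \<epsilon>"
      by simp
  qed
  have lap: "laplacian g X - laplacian g Y \<le> \<epsilon> * ?n"
    unfolding laplacian_def sum_subtractf[symmetric]
    using sum_mono[of UNIV "\<lambda>i. partial i (partial i g) X - partial i (partial i g) Y" "\<lambda>_. \<epsilon>"] trans(2)
    by (simp add: mult.commute)
  \<comment> \<open>The gradient of g at X: the unit gradient at Y plus the gradient of the
    penalty.\<close>
  define w where "w = (\<epsilon> / p X) *\<^sub>R X - (1 / norm v) *\<^sub>R v"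
  have gX: "partial i g X = w $ i" for i
    using trans(1)[of i] gY[of i] by (simp add: w_def)
  have NX: "(\<Sum>i\<in>UNIV. (partial i g X)\<^sup>2) = (norm w)\<^sup>2"
    unfolding norm_power2_sum gX ..
  have NY: "(\<Sum>i\<in>UNIV. (partial i g Y)\<^sup>2) = 1"
    unfolding gY using v
    by (simp add: power_divide sum_divide_distrib[symmetric] norm_power2_sum[symmetric])
  have "norm ((\<epsilon> / p X) *\<^sub>R X) \<le> \<epsilon>"
    using px[of X] p1[of X] \<epsilon>(1) by (simp add: divide_le_eq mult_left_mono)
  moreover have "norm ((1 / norm v) *\<^sub>R v) = 1"
    using v by simp
  ultimately have w: "\<bar>norm w - 1\<bar> \<le> \<epsilon>"
    unfolding w_def
    using norm_triangle_ineq3[of "(1 / norm v) *\<^sub>R v" "(\<epsilon> / p X) *\<^sub>R X"]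
      norm_triangle_ineq4[of "(\<epsilon> / p X) *\<^sub>R X" "(1 / norm v) *\<^sub>R v"]
      norm_minus_commute[of "(\<epsilon> / p X) *\<^sub>R X" "(1 / norm v) *\<^sub>R v"]
    by linarith
  have "\<bar>(norm w)\<^sup>2 - 1\<bar> = \<bar>norm w - 1\<bar> * (norm w + 1)"
  proof -
    have "(norm w)\<^sup>2 - 1 = (norm w - 1) * (norm w + 1)"
      by algebra
    then show ?thesis
      by (simp add: abs_mult)
  qed
  also have "\<dots> \<le> \<epsilon> * 3"
    using w \<epsilon> by (intro mult_mono) auto
  finally have w2: "\<bar>(norm w)\<^sup>2 - 1\<bar> \<le> 3 * \<epsilon>"
    by simp
  have "\<bar>sqrt 2 * u X * ((norm w)\<^sup>2 - 1)\<bar> \<le> (2 * 1) * (3 * \<epsilon>)"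
    unfolding abs_mult using w2 u1 by (intro mult_mono) (auto intro: real_le_lsqrt)
  then have err: "sqrt 2 * u X * ((norm w)\<^sup>2 - 1) \<ge> - 6 * \<epsilon>"
    by simp
  have uXY: "u X > u Y"
    using gXY Z layer_inv_mono[of "u X" "u Y" c] uc by (force simp: g_def not_less[symmetric])
  \<comment> \<open>On [-1, 1] the slope of \<open>layer_inv c\<close> is at most sqrt 2 / (c^2 -
    1), so a gap Z / 2 in g needs a proportional gap in u.\<close>
  have diff: "u X - u Y \<ge> (c\<^sup>2 - 1) / sqrt 2 * (Z / 2)"
  proof -
    obtain z where z: "u Y < z" "z < u X"
      "layer_inv c (u X) - layer_inv c (u Y) = (u X - u Y) * (sqrt 2 / (c\<^sup>2 - z\<^sup>2))"
      using MVT2[OF uXY, of "layer_inv c" "\<lambda>s. sqrt 2 / (c\<^sup>2 - s\<^sup>2)"] layer_inv_deriv[of _ c] uc[of X] uc[of Y]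
      by (auto simp: abs_less_iff)
    have "\<bar>z\<bar> \<le> 1"
      using z u1[of X] u1[of Y] by auto
    then have "z\<^sup>2 \<le> 1"
      by (simp add: abs_square_le_1)
    then have "sqrt 2 / (c\<^sup>2 - z\<^sup>2) \<le> sqrt 2 / (c\<^sup>2 - 1)"
      using c2 by (intro divide_left_mono) auto
    then have "Z / 2 \<le> (u X - u Y) * (sqrt 2 / (c\<^sup>2 - 1))"
      using gXY z(3) mult_left_mono[of "sqrt 2 / (c\<^sup>2 - z\<^sup>2)" "sqrt 2 / (c\<^sup>2 - 1)" "u X - u Y"] uXY
      unfolding g_def by linarith
    then show ?thesis
      using c2 by (simp add: field_simps)
  qed
  \<comment> \<open>Over the common denominator the numerator is (c^2 + u X u Y) (u X - u Y); the
    first factor is at least c^2 - 1 and the denominator at most c^4.\<close>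
  have "u X / (c\<^sup>2 - (u X)\<^sup>2) - u Y / (c\<^sup>2 - (u Y)\<^sup>2) \<ge> (c\<^sup>2 - 1) / c ^ 4 * (u X - u Y)"
  proof -
    have pos: "c\<^sup>2 - (u X)\<^sup>2 > 0" "c\<^sup>2 - (u Y)\<^sup>2 > 0"
      using square_less_if_abs_less[OF uc] by auto
    have "\<bar>u X * u Y\<bar> \<le> 1 * 1"
      unfolding abs_mult by (intro mult_mono u1) auto
    then have "c\<^sup>2 - 1 \<le> c\<^sup>2 + u X * u Y"
      by linarith
    then have "(c\<^sup>2 - 1) * (u X - u Y) \<le> (c\<^sup>2 + u X * u Y) * (u X - u Y)"
      using uXY by (intro mult_right_mono) auto
    moreover have "(c\<^sup>2 - (u X)\<^sup>2) * (c\<^sup>2 - (u Y)\<^sup>2) \<le> c\<^sup>2 * c\<^sup>2"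
      using pos by (intro mult_mono) auto
    ultimately have "(c\<^sup>2 - 1) * (u X - u Y) / c ^ 4
        \<le> (c\<^sup>2 + u X * u Y) * (u X - u Y) / ((c\<^sup>2 - (u X)\<^sup>2) * (c\<^sup>2 - (u Y)\<^sup>2))"
      using pos c2 uXY by (intro frac_le) (auto simp: power2_eq_square power4_eq_xxxx mult.assoc)
    also have "\<dots> = u X / (c\<^sup>2 - (u X)\<^sup>2) - u Y / (c\<^sup>2 - (u Y)\<^sup>2)"
      using pos by (simp add: diff_frac_eq) (simp add: algebra_simps power2_eq_square)
    finally show ?thesis
      by simp
  qed
  moreover have "(c\<^sup>2 - 1) / c ^ 4 * ((c\<^sup>2 - 1) / sqrt 2 * (Z / 2)) \<le> (c\<^sup>2 - 1) / c ^ 4 * (u X - u Y)"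
    using diff c2 by (intro mult_left_mono) auto
  ultimately have "sqrt 2 * (c\<^sup>2 - 1) * ((c\<^sup>2 - 1) / c ^ 4 * ((c\<^sup>2 - 1) / sqrt 2 * (Z / 2)))
     \<le> sqrt 2 * (c\<^sup>2 - 1) * (u X / (c\<^sup>2 - (u X)\<^sup>2) - u Y / (c\<^sup>2 - (u Y)\<^sup>2))"
    using c2 by (intro mult_left_mono) auto
  also have "sqrt 2 * (c\<^sup>2 - 1) * ((c\<^sup>2 - 1) / c ^ 4 * ((c\<^sup>2 - 1) / sqrt 2 * (Z / 2))) = \<kappa>"
    by (simp add: \<kappa>_def power3_eq_cube)
  finally have "\<kappa> - 6 * \<epsilon> \<le> laplacian g X - laplacian g Y"
    using err unfolding g(3) NX NY by (simp add: algebra_simps)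
  with lap \<epsilon>(4) \<kappa> show False
    by (simp add: algebra_simps)
qed


text \<open>Exponentiating the Lipschitz bound removes the logarithms, so the limit c \<rightarrow>
  1 can be taken even where u might equal 1 or -1. Both the strict bound and the Lipschitz bound for
  c = 1 follow from this one inequality.\<close>

lemma allen_cahn_harnack:
  fixes u :: "real ^ 'n \<Rightarrow> real"
  assumes u: "allen_cahn_classical_solution u"
  shows "(1 + u x) * (1 - u y) \<le> exp (sqrt 2 * norm (x - y)) * ((1 - u x) * (1 + u y))"
proof -
  have le: "(c + u x) * (c - u y) \<le> exp (sqrt 2 * c * norm (x - y)) * ((c - u x) * (c + u y))" if c: "c > 1" for c
  proof -
    have pos: "c + u z > 0" "c - u z > 0" for z
      using allen_cahn_abs_le_1[OF u, of z] c by linarith+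
    have "(ln (c + u x) - ln (c - u x)) - (ln (c + u y) - ln (c - u y)) \<le> norm (x - y) * (sqrt 2 * c)"
      using allen_cahn_layer_inv_lipschitz[OF u c, of x y] c
      unfolding layer_inv_def diff_divide_distrib[symmetric] by (subst (asm) pos_divide_le_eq) auto
    then have "ln ((c + u x) * (c - u y)) \<le> sqrt 2 * c * norm (x - y) + ln ((c - u x) * (c + u y))"
      unfolding ln_mult_pos[OF pos(1) pos(2)] ln_mult_pos[OF pos(2) pos(1)] by (simp add: mult.commute)
    then have "exp (ln ((c + u x) * (c - u y))) \<le> exp (sqrt 2 * c * norm (x - y) + ln ((c - u x) * (c + u y)))"
      by (rule exp_le_cancel_iff[THEN iffD2])
    then show ?thesis
      using pos by (simp add: exp_add)
  qed
  have "((\<lambda>c. (c + u x) * (c - u y)) \<longlongrightarrow> (1 + u x) * (1 - u y)) (at_right 1)"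
    "((\<lambda>c. exp (sqrt 2 * c * norm (x - y)) * ((c - u x) * (c + u y))) \<longlongrightarrow>
      exp (sqrt 2 * 1 * norm (x - y)) * ((1 - u x) * (1 + u y))) (at_right 1)"
    by (intro tendsto_intros)+
  from tendsto_le[OF _ this(2,1)] le show ?thesis
    by (simp add: eventually_at_right_less eventually_mono[OF eventually_at_right_less])
qed

text \<open>If u touches 1 or -1 at one point, a side of the Harnack inequality vanishes for every
  second point, and u is constant.\<close>

lemma allen_cahn_abs_less_1:
  fixes u :: "real ^ 'n \<Rightarrow> real"
  assumes u: "allen_cahn_classical_solution u" and "\<not> u constant_on UNIV"
  shows "\<bar>u x\<bar> < 1"
proof (rule ccontr)
  assume "\<not> ?thesis"
  with allen_cahn_abs_le_1[OF u, of x] consider "u x = 1" | "u x = - 1"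
    by (auto simp: abs_if split: if_splits)
  then have "u y = u x" for y
  proof cases
    case 1
    then show ?thesis
      using allen_cahn_harnack[OF u, of x y] allen_cahn_abs_le_1[OF u, of y] by auto
  next
    case 2
    then show ?thesis
      using allen_cahn_harnack[OF u, of y x] allen_cahn_abs_le_1[OF u, of y] by auto
  qed
  with assms(2) show False
    by (auto simp: constant_on_def)
qed

text \<open>In the direction of the gradient G, g grows at rate |G|^2 while the distance grows only
  at rate |G|.\<close>

lemma gradient_bound_if_lipschitz:
  fixes g :: "real ^ 'n \<Rightarrow> real"
  assumes d: "g differentiable (at x)" and lip: "\<And>y. g y - g x \<le> norm (y - x)"
  shows "(\<Sum>i\<in>UNIV. (partial i g x)\<^sup>2) \<le> 1"
proof (rule ccontr)
  define G where "G = (\<chi> i. partial i g x)"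
  assume "\<not> ?thesis"
  then have "(norm G)\<^sup>2 > 1"
    by (simp add: norm_power2_sum G_def)
  then have G: "norm G > 1"
    by (metis abs_norm_cancel abs_square_le_1 not_le)
  have "((\<lambda>t. x + t *\<^sub>R G) has_derivative (\<lambda>h. h *\<^sub>R G)) (at 0)"
    by (auto intro!: derivative_eq_intros)
  from has_derivative_compose[OF this, of g "\<lambda>h. \<Sum>i\<in>UNIV. partial i g x * h $ i"] differentiable_has_gradient[OF d]
  have "((\<lambda>t. g (x + t *\<^sub>R G)) has_derivative (\<lambda>h. \<Sum>i\<in>UNIV. partial i g x * (h *\<^sub>R G) $ i)) (at 0)"
    by simp
  also have "(\<lambda>h. \<Sum>i\<in>UNIV. partial i g x * (h *\<^sub>R G) $ i) = (*) ((norm G)\<^sup>2)"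
    unfolding norm_power2_sum by (simp add: fun_eq_iff G_def sum_distrib_left power2_eq_square mult_ac)
  finally have "((\<lambda>t. g (x + t *\<^sub>R G)) has_real_derivative (norm G)\<^sup>2) (at 0)"
    by (simp add: has_field_derivative_def)
  then have "((\<lambda>t. g (x + t *\<^sub>R G) - t * norm G) has_real_derivative (norm G)\<^sup>2 - norm G) (at 0)"
    by (auto intro!: derivative_eq_intros)
  moreover have "(norm G)\<^sup>2 - norm G > 0"
  proof -
    have "norm G * (norm G - 1) > 0"
      using G by (intro mult_pos_pos) auto
    then show ?thesis
      by (simp add: power2_eq_square right_diff_distrib)
  qed
  ultimately obtain e where e: "e > 0"
    "\<And>h. 0 < h \<Longrightarrow> h < e \<Longrightarrow> g (x + 0 *\<^sub>R G) - 0 * norm G < g (x + (0 + h) *\<^sub>R G) - (0 + h) * norm G"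
    using DERIV_pos_inc_right by blast
  from e(2)[of "e / 2"] e(1) lip[of "x + (e / 2) *\<^sub>R G"] show False
    by simp
qed

text \<open>Since \<nabla>g = sqrt 2 \<nabla>u / (1 - u^2), this is Modica's bound 2 |\<nabla>u|^2
  \<le> (1 - u^2)^2. The strict bound on u permits taking logarithms in the Harnack inequality
  again.\<close>

lemma allen_cahn_modica:
  fixes u :: "real ^ 'n \<Rightarrow> real"
  assumes u: "allen_cahn_classical_solution u" and nc: "\<not> u constant_on UNIV"
  shows "(\<Sum>i\<in>UNIV. (partial i (\<lambda>x. layer_inv 1 (u x)) x)\<^sup>2) \<le> 1"
proof (rule gradient_bound_if_lipschitz)
  note lt = allen_cahn_abs_less_1[OF u nc]
  show "(\<lambda>x. layer_inv 1 (u x)) differentiable at x"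
    by (rule C2_differentiable[OF allen_cahn_layer_inv(1)[OF u lt]])
  show "layer_inv 1 (u y) - layer_inv 1 (u x) \<le> norm (y - x)" for y
  proof -
    have pos: "1 + u z > 0" "1 - u z > 0" for z
      using lt[of z] by auto
    have "ln ((1 + u y) * (1 - u x)) \<le> ln (exp (sqrt 2 * norm (y - x)) * ((1 - u y) * (1 + u x)))"
      using allen_cahn_harnack[OF u, of y x] pos by (subst ln_le_cancel_iff) auto
    also have "\<dots> = sqrt 2 * norm (y - x) + ln ((1 - u y) * (1 + u x))"
      using pos by (subst ln_mult_pos) auto
    finally have "(ln (1 + u y) - ln (1 - u y)) - (ln (1 + u x) - ln (1 - u x)) \<le> norm (y - x) * sqrt 2"
      unfolding ln_mult_pos[OF pos(1) pos(2)] ln_mult_pos[OF pos(2) pos(1)] by (simp add: mult.commute)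
    then show ?thesis
      by (simp add: layer_inv_def diff_divide_distrib[symmetric] pos_divide_le_eq)
  qed
qed

subsection \<open>Riccati inequalities for plane vector fields\<close>

text \<open>One component of the divergence theorem on a rectangle: Fubini places the integration
  along the derivative inside.\<close>

lemma integral_pderiv_fst_eq_0:
  fixes A A' :: "real \<times> real \<Rightarrow> real"
  assumes "a \<le> b" and cont: "continuous_on (cbox (a, c) (b, d)) A'"
    and deriv: "\<And>x y. ((\<lambda>s. A (s, y)) has_real_derivative A' (x, y)) (at x)"
    and bd: "\<And>y. A (a, y) = A (b, y)"
  shows "integral (cbox (a, c) (b, d)) A' = 0"
proof -
  have "integral (cbox (a, c) (b, d)) A' = integral (cbox a b) (\<lambda>x. integral (cbox c d) (\<lambda>y. A' (x, y)))"
    by (rule integral_prod_continuous[OF cont])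
  also have "\<dots> = integral (cbox c d) (\<lambda>y. integral (cbox a b) (\<lambda>x. A' (x, y)))"
    using cont by (intro integral_swap_continuous) (simp add: case_prod_unfold)
  also have "(\<lambda>y. integral (cbox a b) (\<lambda>x. A' (x, y))) = (\<lambda>y. A (b, y) - A (a, y))"
  proof
    fix y
    have "((\<lambda>x. A' (x, y)) has_integral A (b, y) - A (a, y)) {a..b}"
      using \<open>a \<le> b\<close> deriv
      by (intro fundamental_theorem_of_calculus)
        (auto simp: has_real_derivative_iff_has_vector_derivative[symmetric] intro: has_field_derivative_at_within)
    then show "integral (cbox a b) (\<lambda>x. A' (x, y)) = A (b, y) - A (a, y)"
      by (simp add: integral_unique)
  qed
  finally show ?thesis
    by (simp add: bd)
qed

lemma integral_pderiv_snd_eq_0: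
  fixes A A' :: "real \<times> real \<Rightarrow> real"
  assumes "c \<le> d" and cont: "continuous_on (cbox (a, c) (b, d)) A'"
    and deriv: "\<And>x y. ((\<lambda>s. A (x, s)) has_real_derivative A' (x, y)) (at y)"
    and bd: "\<And>x. A (x, c) = A (x, d)"
  shows "integral (cbox (a, c) (b, d)) A' = 0"
proof -
  have "integral (cbox (a, c) (b, d)) A' = integral (cbox (c, a) (d, b)) (\<lambda>p. A' (snd p, fst p))"
    using integral_swap_2dim[of a c b d "\<lambda>x y. A' (x, y)"] cont by (simp add: case_prod_unfold)
  also have "\<dots> = 0"
  proof (rule integral_pderiv_fst_eq_0[where A = "\<lambda>p. A (snd p, fst p)"])
    show "continuous_on (cbox (c, a) (d, b)) (\<lambda>p. A' (snd p, fst p))"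
      by (rule continuous_on_compose2[OF cont]) (auto intro!: continuous_intros)
  qed (use assms in auto)
  finally show ?thesis .
qed

section \<open>A continuously differentiable cutoff\<close>

lemma max_0_power2_deriv: "((\<lambda>s. (max 0 s)\<^sup>2) has_real_derivative 2 * max 0 x) (at x)" for x :: real
proof (cases x "0 :: real" rule: linorder_cases)
  case less
  have ev: "\<forall>\<^sub>F s in nhds x. (max 0 s)\<^sup>2 = 0"
    by (rule eventually_mono[OF eventually_nhds_in_open[of "{..<0}"]]) (use less in auto)
  show ?thesis
    by (rule DERIV_cong_ev[OF refl ev refl, THEN iffD2]) (use less in simp)
next
  case greater
  have ev: "\<forall>\<^sub>F s in nhds x. (max 0 s)\<^sup>2 = s\<^sup>2"
    by (rule eventually_mono[OF eventually_nhds_in_open[of "{0<..}"]]) (use greater in auto)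
  show ?thesis
    by (rule DERIV_cong_ev[OF refl ev refl, THEN iffD2])
      (use greater in \<open>auto intro!: derivative_eq_intros\<close>)
next
  case equal
  have "((\<lambda>h :: real. ((max 0 (0 + h))\<^sup>2 - (max 0 0)\<^sup>2) / h) \<longlongrightarrow> 0) (at 0)"
  proof (rule Lim_null_comparison)
    show "\<forall>\<^sub>F h :: real in at 0. norm (((max 0 (0 + h))\<^sup>2 - (max 0 0)\<^sup>2) / h) \<le> \<bar>h\<bar>"
      by (intro always_eventually allI) (auto simp: max_def power2_eq_square)
    show "((\<lambda>h :: real. \<bar>h\<bar>) \<longlongrightarrow> 0) (at 0)"
      by (rule tendsto_eq_intros refl | simp)+
  qed
  then show ?thesis
    using equal by (simp add: DERIV_def)
qed

text \<open>Equals 1 on [-1, 1] and falls to 0 at 2 and -2. It becomes negative beyond, so it is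
  used only on squares where |s| \<le> 2.\<close>

definition cutoff :: "real \<Rightarrow> real" where
  "cutoff s = 1 - (max 0 (s - 1))\<^sup>2 - (max 0 (- s - 1))\<^sup>2"

definition cutoff' :: "real \<Rightarrow> real" where
  "cutoff' s = - 2 * max 0 (s - 1) + 2 * max 0 (- s - 1)"

lemma cutoff_deriv: "(cutoff has_real_derivative cutoff' s) (at s)"
proof -
  have "((\<lambda>s. (max 0 (s - 1))\<^sup>2) has_real_derivative 2 * max 0 (s - 1) * 1) (at s)"
    by (rule DERIV_chain2[OF max_0_power2_deriv]) (auto intro!: derivative_eq_intros)
  moreover have "((\<lambda>s. (max 0 (- s - 1))\<^sup>2) has_real_derivative 2 * max 0 (- s - 1) * (- 1)) (at s)"
    by (rule DERIV_chain2[OF max_0_power2_deriv]) (auto intro!: derivative_eq_intros)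
  ultimately have "(cutoff has_real_derivative 0 - 2 * max 0 (s - 1) * 1 - 2 * max 0 (- s - 1) * (- 1)) (at s)"
    unfolding cutoff_def[abs_def] by (intro DERIV_diff DERIV_const)
  then show ?thesis
    by (simp add: cutoff'_def)
qed

lemma cutoff_inner: "\<bar>s\<bar> \<le> 1 \<Longrightarrow> cutoff s = 1 \<and> cutoff' s = 0"
  by (auto simp: cutoff_def cutoff'_def max_def)

lemma cutoff_bounds:
  assumes "\<bar>s\<bar> \<le> 2"
  shows "0 \<le> cutoff s" "cutoff s \<le> 1" "\<bar>cutoff' s\<bar> \<le> 2"
proof -
  consider "s > 1" | "s < - 1" | "\<bar>s\<bar> \<le> 1"
    by linarith
  then have "0 \<le> cutoff s \<and> cutoff s \<le> 1 \<and> \<bar>cutoff' s\<bar> \<le> 2"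
  proof cases
    case 1
    then have "cutoff s = 1 - (s - 1)\<^sup>2" "cutoff' s = - 2 * (s - 1)" "\<bar>s - 1\<bar> \<le> 1"
      using assms by (auto simp: cutoff_def cutoff'_def)
    moreover from this(3) have "(s - 1)\<^sup>2 \<le> 1"
      by (simp add: abs_square_le_1)
    ultimately show ?thesis
      by auto
  next
    case 2
    then have "cutoff s = 1 - (- s - 1)\<^sup>2" "cutoff' s = 2 * (- s - 1)" "\<bar>- s - 1\<bar> \<le> 1"
      using assms by (auto simp: cutoff_def cutoff'_def)
    moreover from this(3) have "(- s - 1)\<^sup>2 \<le> 1"
      by (simp only: abs_square_le_1)
    ultimately show ?thesis
      by auto
  next
    case 3
    then show ?thesis
      using cutoff_inner by simp
  qed
  then show "0 \<le> cutoff s" "cutoff s \<le> 1" "\<bar>cutoff' s\<bar> \<le> 2"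
    by auto
qed

lemma cutoff_boundary: "cutoff 2 = 0" "cutoff (- 2) = 0"
  by (auto simp: cutoff_def)

lemma continuous_on_cutoff [continuous_intros]:
  "continuous_on S f \<Longrightarrow> continuous_on S (\<lambda>x. cutoff (f x))"
  "continuous_on S f \<Longrightarrow> continuous_on S (\<lambda>x. cutoff' (f x))"
  unfolding cutoff_def cutoff'_def by (intro continuous_intros; assumption)+

text \<open>The components of a field Y with div Y + |Y|^2 \<le> 0. In the model case Y =
  \<nabla>(log f) the inequality says that f > 0 is superharmonic, and \<open>vanishes\<close> is
  Liouville's theorem for such f on the plane.\<close>

locale plane_riccati =
  fixes P Px Q Qy :: "real \<times> real \<Rightarrow> real"
  assumes cont: "continuous_on UNIV P" "continuous_on UNIV Px" "continuous_on UNIV Q" "continuous_on UNIV Qy"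
    and P_deriv: "\<And>x y. ((\<lambda>s. P (s, y)) has_real_derivative Px (x, y)) (at x)"
    and Q_deriv: "\<And>x y. ((\<lambda>s. Q (x, s)) has_real_derivative Qy (x, y)) (at y)"
    and riccati: "\<And>p. Px p + Qy p + (P p)\<^sup>2 + (Q p)\<^sup>2 \<le> 0"
begin

definition energy :: "real \<Rightarrow> real" where
  "energy R = integral (cbox (- R, - R) (R, R)) (\<lambda>p. (P p)\<^sup>2 + (Q p)\<^sup>2)"

lemma cont_on: "continuous_on S P" "continuous_on S Px" "continuous_on S Q" "continuous_on S Qy"
  using cont continuous_on_subset by (metis subset_UNIV)+

text \<open>J is the energy weighted by the squared cutoff. Testing the inequality with that weight
  and integrating by parts leaves 2 \<xi> \<nabla>\<xi> \<bullet> Y, which Young's inequality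
  splits. As \<nabla>\<xi> vanishes on the inner square, c multiplies only the energy outside
  it.\<close>

lemma caccioppoli:
  assumes R: "R > 0"
  obtains J where "energy R \<le> J" "J \<le> energy (2 * R)"
    "\<And>c. c > 0 \<Longrightarrow> J \<le> c * (J - energy R) + 128 / c"
proof -
  let ?S = "cbox (- (2 * R), - (2 * R)) (2 * R, 2 * R) :: (real \<times> real) set"
  let ?S1 = "cbox (- R, - R) (R, R) :: (real \<times> real) set"
  define f where "f = (\<lambda>p. (P p)\<^sup>2 + (Q p)\<^sup>2)"
  define \<xi> where "\<xi> = (\<lambda>p. cutoff (fst p / R) * cutoff (snd p / R))"
  define \<xi>x where "\<xi>x = (\<lambda>p. cutoff' (fst p / R) / R * cutoff (snd p / R))"
  define \<xi>y where "\<xi>y = (\<lambda>p. cutoff (fst p / R) * (cutoff' (snd p / R) / R))"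
  \<comment> \<open>\<open>A\<close> and \<open>B\<close> are the derivatives of \<xi>^2 P and
    \<xi>^2 Q in the first and second variable; their integrals vanish with the cutoff on the
    boundary.\<close>
  define A where "A = (\<lambda>p. 2 * \<xi> p * \<xi>x p * P p + (\<xi> p)\<^sup>2 * Px p)"
  define B where "B = (\<lambda>p. 2 * \<xi> p * \<xi>y p * Q p + (\<xi> p)\<^sup>2 * Qy p)"
  \<comment> \<open>Extension by zero writes \<open>J - energy R\<close> as one integral over the
    large square.\<close>
  define f1 where "f1 = (\<lambda>p. if p \<in> ?S1 then f p else 0)"
  define J where "J = integral ?S (\<lambda>p. (\<xi> p)\<^sup>2 * f p)"
  have c\<xi>: "continuous_on S \<xi>" "continuous_on S \<xi>x" "continuous_on S \<xi>y" for S
    unfolding \<xi>_def \<xi>x_def \<xi>y_def using R by (auto intro!: continuous_intros)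
  have cf: "continuous_on S f" for S
    unfolding f_def by (intro continuous_intros cont_on)
  have cAB: "continuous_on S A" "continuous_on S B" for S
    unfolding A_def B_def by (intro continuous_intros cont_on c\<xi>)+
  have cutd: "((\<lambda>s. cutoff (s / R)) has_real_derivative cutoff' (x / R) / R) (at x)" for x
  proof -
    have "((\<lambda>s. s / R) has_real_derivative 1 / R) (at x)"
      using R by (auto intro!: derivative_eq_intros)
    from DERIV_chain2[OF cutoff_deriv this] show ?thesis
      by simp
  qed
  have intA: "integral ?S A = 0"
  proof (rule integral_pderiv_fst_eq_0[where A = "\<lambda>p. (\<xi> p)\<^sup>2 * P p"])
    show "((\<lambda>s. (\<xi> (s, y))\<^sup>2 * P (s, y)) has_real_derivative A (x, y)) (at x)" for x y
      unfolding A_def \<xi>_def \<xi>x_def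
      by (auto intro!: derivative_eq_intros cutd P_deriv simp: algebra_simps power2_eq_square)
  qed (use R cAB in \<open>auto simp: \<xi>_def cutoff_boundary\<close>)
  have intB: "integral ?S B = 0"
  proof (rule integral_pderiv_snd_eq_0[where A = "\<lambda>p. (\<xi> p)\<^sup>2 * Q p"])
    show "((\<lambda>s. (\<xi> (x, s))\<^sup>2 * Q (x, s)) has_real_derivative B (x, y)) (at y)" for x y
      unfolding B_def \<xi>_def \<xi>y_def
      by (auto intro!: derivative_eq_intros cutd Q_deriv simp: algebra_simps power2_eq_square)
  qed (use R cAB in \<open>auto simp: \<xi>_def cutoff_boundary\<close>)
  have S1: "?S1 \<subseteq> ?S"
    using R by auto
  have int\<xi>: "(\<lambda>p. (\<xi> p)\<^sup>2 * f p) integrable_on ?S"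
    by (intro integrable_continuous continuous_intros c\<xi> cf)
  have intf: "f integrable_on cbox a b" for a b
    by (intro integrable_continuous cf)
  have f1: "f1 integrable_on ?S" "integral ?S f1 = energy R"
    using S1 intf unfolding f1_def integrable_restrict_Int integral_restrict_Int energy_def
    by (simp_all add: Int_absorb2 f_def)
  have f0: "f p \<ge> 0" for p
    by (simp add: f_def)
  have scaled: "\<bar>fst p / R\<bar> \<le> 2 \<and> \<bar>snd p / R\<bar> \<le> 2" if "p \<in> ?S" for p
    using that R by (cases p) (auto simp: abs_le_iff field_simps)
  have scaled1: "\<bar>fst p / R\<bar> \<le> 1 \<and> \<bar>snd p / R\<bar> \<le> 1" if "p \<in> ?S1" for p
    using that R by (cases p) (auto simp: abs_le_iff field_simps)
  have \<xi>1: "\<xi> p = 1 \<and> \<xi>x p = 0 \<and> \<xi>y p = 0" if "p \<in> ?S1" for p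
    using scaled1[OF that] cutoff_inner by (simp add: \<xi>_def \<xi>x_def \<xi>y_def)
  have \<xi>le: "(\<xi> p)\<^sup>2 \<le> 1" "(\<xi>x p)\<^sup>2 \<le> 4 / R\<^sup>2" "(\<xi>y p)\<^sup>2 \<le> 4 / R\<^sup>2" if "p \<in> ?S" for p
  proof -
    note s = scaled[OF that]
    note cb = cutoff_bounds[OF conjunct1[OF s]] cutoff_bounds[OF conjunct2[OF s]]
    have "\<bar>\<xi> p\<bar> \<le> 1 * 1"
      unfolding \<xi>_def abs_mult using cb by (intro mult_mono) auto
    then show "(\<xi> p)\<^sup>2 \<le> 1"
      by (simp add: abs_square_le_1)
    have "\<bar>\<xi>x p\<bar> \<le> (2 / R) * 1" "\<bar>\<xi>y p\<bar> \<le> 1 * (2 / R)"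
      unfolding \<xi>x_def \<xi>y_def abs_mult abs_divide using cb R by (intro mult_mono divide_right_mono; simp)+
    then have "(\<xi>x p)\<^sup>2 \<le> (2 / R)\<^sup>2" "(\<xi>y p)\<^sup>2 \<le> (2 / R)\<^sup>2"
      by (simp_all only: mult_1_right mult_1_left abs_le_square_iff[symmetric] abs_of_nonneg abs_ge_zero order_trans[OF _ abs_ge_self])
    then show "(\<xi>x p)\<^sup>2 \<le> 4 / R\<^sup>2" "(\<xi>y p)\<^sup>2 \<le> 4 / R\<^sup>2"
      by (simp_all add: power_divide)
  qed
  have young: "2 * a * b \<le> c * a\<^sup>2 + b\<^sup>2 / c" if "c > 0" for a b c :: real
  proof -
    have "c * a\<^sup>2 + b\<^sup>2 / c - 2 * a * b = (c * a - b)\<^sup>2 / c"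
      using that by (simp add: field_simps power2_eq_square)
    also have "\<dots> \<ge> 0"
      using that by simp
    finally show ?thesis
      by simp
  qed
  show ?thesis
  proof
    show "energy R \<le> J"
      unfolding f1(2)[symmetric] J_def
      using \<xi>1 f0 by (intro integral_le f1 int\<xi>) (auto simp: f1_def)
    show "J \<le> energy (2 * R)"
      unfolding J_def energy_def f_def[symmetric]
      using \<xi>le f0 by (intro integral_le intf int\<xi>) (simp add: mult_left_le_one_le)
    show "J \<le> c * (J - energy R) + 128 / c" if c: "c > 0" for c
    proof -
      \<comment> \<open>On the inner square \<xi> = 1, so the bracket after c is zero and the cross
        terms vanish; elsewhere \<open>f1 p = 0\<close> and Young's inequality applies.\<close>
      have pw: "(\<xi> p)\<^sup>2 * f p + A p + B p \<le> c * ((\<xi> p)\<^sup>2 * f p - f1 p) + 8 / R\<^sup>2 / c" if p: "p \<in> ?S" for p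
      proof -
        have "(\<xi> p)\<^sup>2 * (Px p + Qy p + (P p)\<^sup>2 + (Q p)\<^sup>2) \<le> 0"
          using riccati[of p] by (simp add: mult_nonneg_nonpos)
        then have 1: "(\<xi> p)\<^sup>2 * f p + A p + B p \<le> 2 * (\<xi> p * P p) * \<xi>x p + 2 * (\<xi> p * Q p) * \<xi>y p"
          by (simp add: A_def B_def f_def algebra_simps)
        also have "\<dots> \<le> c * ((\<xi> p)\<^sup>2 * f p - f1 p) + 8 / R\<^sup>2 / c"
        proof (cases "p \<in> ?S1")
          case True
          then show ?thesis
            using \<xi>1[OF True] c by (simp add: f1_def)
        next
          case False
          have "2 * (\<xi> p * P p) * \<xi>x p + 2 * (\<xi> p * Q p) * \<xi>y p
              \<le> (c * (\<xi> p * P p)\<^sup>2 + (\<xi>x p)\<^sup>2 / c) + (c * (\<xi> p * Q p)\<^sup>2 + (\<xi>y p)\<^sup>2 / c)"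
            by (intro add_mono young c)
          also have "\<dots> \<le> (c * (\<xi> p * P p)\<^sup>2 + (4 / R\<^sup>2) / c) + (c * (\<xi> p * Q p)\<^sup>2 + (4 / R\<^sup>2) / c)"
            using c \<xi>le[OF p] by (intro add_mono divide_right_mono) auto
          also have "\<dots> = c * ((\<xi> p)\<^sup>2 * f p - f1 p) + 8 / R\<^sup>2 / c"
            using False by (simp add: f1_def f_def power_mult_distrib algebra_simps add_divide_distrib[symmetric])
          finally show ?thesis .
        qed
        finally show ?thesis .
      qed
      have "J = integral ?S (\<lambda>p. (\<xi> p)\<^sup>2 * f p) + integral ?S A + integral ?S B"
        by (simp add: J_def intA intB)
      also have "\<dots> = integral ?S (\<lambda>p. (\<xi> p)\<^sup>2 * f p + A p + B p)"
        using int\<xi> integrable_continuous[OF cAB(1)] integrable_continuous[OF cAB(2)]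
        by (simp add: integral_add integrable_add)
      also have "\<dots> \<le> integral ?S (\<lambda>p. c * ((\<xi> p)\<^sup>2 * f p - f1 p) + 8 / R\<^sup>2 / c)"
        by (intro integral_le pw integrable_add integrable_on_mult_right integrable_diff int\<xi> f1 integrable_const
             integrable_continuous cAB)
      also have "\<dots> = c * (J - energy R) + measure lborel ?S * (8 / R\<^sup>2 / c)"
        using int\<xi> f1 unfolding J_def f1(2)[symmetric]
        by (subst integral_add) (auto simp: integral_diff intro!: integrable_on_mult_right integrable_diff)
      \<comment> \<open>The area 16 R^2 cancels the factor 1 / R^2, which is where dimension two
        enters: the error does not depend on R.\<close>
      also have "measure lborel ?S * (8 / R\<^sup>2 / c) = 128 / c"
        using R c by (simp add: content_Pair power2_eq_square)
      finally show ?thesis .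
    qed
  qed
qed

text \<open>The choice c = 1/2 bounds the energy uniformly in the radius, while a positive energy
  would increase by a fixed amount each time the radius doubles.\<close>

lemma energy_eq_0:
  assumes R: "R > 0"
  shows "energy R = 0"
proof (rule ccontr)
  assume "energy R \<noteq> 0"
  moreover have "energy R \<ge> 0"
    unfolding energy_def by (intro integral_nonneg integrable_continuous continuous_intros cont_on) auto
  ultimately have pos: "energy R > 0"
    by simp
  define a where "a = energy R"
  have a: "a > 0"
    using pos by (simp add: a_def)
  have bound: "energy r \<le> 512" if "r > 0" for r
  proof -
    from caccioppoli[OF that] obtain J where "energy r \<le> J" "J \<le> 1 / 2 * (J - energy r) + 128 / (1 / 2)"
      by (metis half_gt_zero_iff zero_less_one)
    then show ?thesis
      by (simp add: field_simps)
  qed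
  have grow: "energy (R * 2 ^ k) \<ge> a + real k * (a\<^sup>2 / 512)" for k
  proof (induction k)
    case 0
    then show ?case by (simp add: a_def)
  next
    case (Suc k)
    define r where "r = R * 2 ^ k"
    have r: "r > 0"
      using R by (simp add: r_def)
    have ar: "energy r \<ge> a"
      using Suc a unfolding r_def by (smt (verit) mult_nonneg_nonneg of_nat_0_le_iff zero_le_divide_iff zero_le_power2)
    \<comment> \<open>With c = 256 / a the error is a / 2, at most half of J, so the energy between
      the squares is at least a^2 / 512.\<close>
    from caccioppoli[OF r] obtain J where J: "energy r \<le> J" "J \<le> energy (2 * r)"
      "J \<le> 256 / a * (J - energy r) + 128 / (256 / a)"
      using a by (metis divide_pos_pos zero_less_numeral)
    have "128 / (256 / a) = a / 2"
      by simp
    then have "a / 2 \<le> 256 / a * (J - energy r)"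
      using J(1,3) ar by linarith
    also have "\<dots> \<le> 256 / a * (energy (2 * r) - energy r)"
      using J(2) a by (intro mult_left_mono) auto
    finally have "a\<^sup>2 / 512 \<le> energy (2 * r) - energy r"
      using a by (simp add: field_simps power2_eq_square)
    then show ?case
      using Suc by (simp add: r_def algebra_simps add_divide_distrib)
  qed
  obtain k :: nat where k: "real k * (a\<^sup>2 / 512) > 512"
    using reals_Archimedean3[of "a\<^sup>2 / 512"] a by (metis divide_pos_pos zero_less_numeral zero_less_power)
  have "energy (R * 2 ^ k) > 512"
    using grow[of k] k a by linarith
  with bound[of "R * 2 ^ k"] R show False
    by simp
qed

lemma vanishes: "P p = 0" "Q p = 0"
proof -
  define R where "R = \<bar>fst p\<bar> + \<bar>snd p\<bar> + 1"
  have R: "R > 0" "p \<in> cbox (- R, - R) (R, R)"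
    by (cases p; auto simp: R_def)+
  have "continuous_on (cbox (- R, - R) (R, R)) (\<lambda>p. (P p)\<^sup>2 + (Q p)\<^sup>2)"
    by (intro continuous_intros cont_on)
  moreover have "(0, 0) \<in> box (- R, - R) (R, R)"
    using R by (auto simp: mem_box Basis_prod_def)
  then have "box (- R, - R) (R, R) \<noteq> {}"
    by blast
  ultimately have "(P p)\<^sup>2 + (Q p)\<^sup>2 = 0"
    using integral_cbox_eq_0_iff[of "(- R, - R)" "(R, R)" "\<lambda>p. (P p)\<^sup>2 + (Q p)\<^sup>2"] energy_eq_0[OF R(1)] R(2)
    unfolding energy_def by auto
  then show "P p = 0" "Q p = 0"
    by (auto simp: sum_power2_eq_zero_iff)
qed

end

subsection \<open>Ordered pairs\<close>

lemma mixed_difference: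
  fixes f :: "real ^ 'n \<Rightarrow> real"
  assumes f: "C2 f" and h: "h > 0"
  obtains s t where "0 < s" "s < h" "0 < t" "t < h"
    "f (x + h *\<^sub>R axis j 1 + h *\<^sub>R axis i 1) - f (x + h *\<^sub>R axis i 1) - f (x + h *\<^sub>R axis j 1) + f x
      = h\<^sup>2 * partial j (partial i f) (x + s *\<^sub>R axis i 1 + t *\<^sub>R axis j 1)"
proof -
  let ?i = "axis i 1 :: real ^ 'n" and ?j = "axis j 1 :: real ^ 'n"
  \<comment> \<open>The second difference is the increment of \<phi> from 0 to h; the mean value
    theorem is applied first along i and then along j.\<close>
  define \<phi> where "\<phi> = (\<lambda>s. f (x + h *\<^sub>R ?j + s *\<^sub>R ?i) - f (x + s *\<^sub>R ?i))"
  have "(\<phi> has_real_derivative partial i f (x + h *\<^sub>R ?j + s *\<^sub>R ?i) - partial i f (x + s *\<^sub>R ?i)) (at s)" for s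
    unfolding \<phi>_def by (intro DERIV_diff has_real_derivative_line C2_differentiable[OF f])
  from MVT2[OF h this] obtain s where s: "0 < s" "s < h"
    "\<phi> h - \<phi> 0 = (h - 0) * (partial i f (x + h *\<^sub>R ?j + s *\<^sub>R ?i) - partial i f (x + s *\<^sub>R ?i))"
    by blast
  have "((\<lambda>t. partial i f (x + s *\<^sub>R ?i + t *\<^sub>R ?j)) has_real_derivative
      partial j (partial i f) (x + s *\<^sub>R ?i + t *\<^sub>R ?j)) (at t)" for t
    by (intro has_real_derivative_line C2_differentiable[OF f])
  from MVT2[OF h this] obtain t where t: "0 < t" "t < h"
    "partial i f (x + s *\<^sub>R ?i + h *\<^sub>R ?j) - partial i f (x + s *\<^sub>R ?i + 0 *\<^sub>R ?j)
      = (h - 0) * partial j (partial i f) (x + s *\<^sub>R ?i + t *\<^sub>R ?j)"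
    by blast
  have comm: "x + h *\<^sub>R ?j + s *\<^sub>R ?i = x + s *\<^sub>R ?i + h *\<^sub>R ?j"
    by simp
  have "\<phi> h - \<phi> 0 = h * (partial i f (x + s *\<^sub>R ?i + h *\<^sub>R ?j) - partial i f (x + s *\<^sub>R ?i + 0 *\<^sub>R ?j))"
    using s(3) by (simp only: comm scaleR_zero_left add_0_right diff_zero)
  also have "\<dots> = h\<^sup>2 * partial j (partial i f) (x + s *\<^sub>R ?i + t *\<^sub>R ?j)"
    unfolding t(3) by (simp add: power2_eq_square)
  finally have "\<phi> h - \<phi> 0 = h\<^sup>2 * partial j (partial i f) (x + s *\<^sub>R ?i + t *\<^sub>R ?j)" .
  with s t that show ?thesis
    by (simp add: \<phi>_def algebra_simps)
qed

text \<open>The second difference is symmetric in i and j, so the two mixed derivatives agree at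
  some pair of points within 2 h of x; continuity excludes a gap at x.\<close>

lemma partial_commute:
  fixes f :: "real ^ 'n \<Rightarrow> real"
  assumes f: "C2 f"
  shows "partial j (partial i f) x = partial i (partial j f) x"
proof (rule ccontr)
  let ?a = "partial j (partial i f)" and ?b = "partial i (partial j f)"
  assume neq: "?a x \<noteq> ?b x"
  define e where "e = \<bar>?a x - ?b x\<bar> / 2"
  have e: "e > 0"
    using neq by (simp add: e_def)
  have "isCont ?a x" "isCont ?b x"
    using C2_continuous(3)[OF f, of UNIV] by (simp_all add: continuous_on_eq_continuous_at)
  then obtain d1 d2 where d: "d1 > 0" "d2 > 0"
    "\<And>y. dist y x < d1 \<Longrightarrow> dist (?a y) (?a x) < e" "\<And>y. dist y x < d2 \<Longrightarrow> dist (?b y) (?b x) < e"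
    using e unfolding continuous_at_eps_delta by metis
  define h where "h = min d1 d2 / 2"
  have h: "h > 0" "2 * h \<le> d1" "2 * h \<le> d2"
    using d by (auto simp: h_def)
  have near: "dist (x + s *\<^sub>R axis k 1 + t *\<^sub>R axis l 1) x < 2 * h"
    if "0 < s" "s < h" "0 < t" "t < h" for s t and k l :: 'n
  proof -
    have "dist (x + s *\<^sub>R axis k 1 + t *\<^sub>R axis l 1) x \<le> norm (s *\<^sub>R axis k 1 :: real ^ 'n) + norm (t *\<^sub>R axis l 1 :: real ^ 'n)"
      by (simp add: dist_norm add.assoc norm_triangle_ineq del: norm_scaleR)
    also have "\<dots> < 2 * h"
      using that by simp
    finally show ?thesis .
  qed
  obtain s t where 1: "0 < s" "s < h" "0 < t" "t < h"
    "f (x + h *\<^sub>R axis j 1 + h *\<^sub>R axis i 1) - f (x + h *\<^sub>R axis i 1) - f (x + h *\<^sub>R axis j 1) + f x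
      = h\<^sup>2 * ?a (x + s *\<^sub>R axis i 1 + t *\<^sub>R axis j 1)"
    by (rule mixed_difference[OF f h(1)])
  obtain s' t' where 2: "0 < s'" "s' < h" "0 < t'" "t' < h"
    "f (x + h *\<^sub>R axis i 1 + h *\<^sub>R axis j 1) - f (x + h *\<^sub>R axis j 1) - f (x + h *\<^sub>R axis i 1) + f x
      = h\<^sup>2 * ?b (x + s' *\<^sub>R axis j 1 + t' *\<^sub>R axis i 1)"
    by (rule mixed_difference[OF f h(1)])
  have comm: "x + h *\<^sub>R axis i 1 + h *\<^sub>R axis j 1 = x + h *\<^sub>R axis j 1 + h *\<^sub>R axis i 1"
    by simp
  have "h\<^sup>2 * ?a (x + s *\<^sub>R axis i 1 + t *\<^sub>R axis j 1) = h\<^sup>2 * ?b (x + s' *\<^sub>R axis j 1 + t' *\<^sub>R axis i 1)"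
    using 1(5) 2(5) unfolding comm by linarith
  then have "?a (x + s *\<^sub>R axis i 1 + t *\<^sub>R axis j 1) = ?b (x + s' *\<^sub>R axis j 1 + t' *\<^sub>R axis i 1)"
    using h(1) by simp
  moreover have "dist (?a (x + s *\<^sub>R axis i 1 + t *\<^sub>R axis j 1)) (?a x) < e"
    "dist (?b (x + s' *\<^sub>R axis j 1 + t' *\<^sub>R axis i 1)) (?b x) < e"
    using near[OF 1(1-4), of i j] near[OF 2(1-4), of j i] h by (auto intro!: d)
  ultimately show False
    unfolding e_def dist_real_def by argo
qed

lemma zero_gradient_imp_constant:
  fixes f :: "real ^ 'n \<Rightarrow> real"
  assumes "\<And>x. f differentiable (at x)" and "\<And>i x. partial i f x = 0"
  shows "f x = f y"
proof -
  have "(f has_derivative (\<lambda>h. 0)) (at x)" for x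
    using differentiable_has_gradient[OF assms(1)[of x]] by (simp add: assms(2))
  then show ?thesis
    using has_derivative_zero_unique_connected[of UNIV f] by (metis UNIV_I connected_UNIV open_UNIV)
qed

lemma partial_inner_diff:
  fixes f :: "real ^ 'n \<Rightarrow> real"
  assumes "f differentiable (at x)"
  shows "(\<lambda>y. f y - y \<bullet> e) differentiable (at x)"
    and "partial i (\<lambda>y. f y - y \<bullet> e) x = partial i f x - e $ i"
proof -
  have D: "((\<lambda>y. f y - y \<bullet> e) has_derivative (\<lambda>h. (\<Sum>i\<in>UNIV. partial i f x * h $ i) - h \<bullet> e)) (at x)"
    using differentiable_has_gradient[OF assms] by (auto intro!: derivative_eq_intros)
  then show "(\<lambda>y. f y - y \<bullet> e) differentiable (at x)"
    by (rule differentiableI)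
  show "partial i (\<lambda>y. f y - y \<bullet> e) x = partial i f x - e $ i"
    unfolding partial_eq[OF D] inner_axis' by (simp add: axis_def if_distrib cong: if_cong)
qed

text \<open>Differentiating |\<nabla>g|^2 = 1 shows that the Hessian annihilates the unit vector
  \<nabla>g. A symmetric trace-free 2 by 2 matrix with rows (a, b) and (b, -a) has determinant -(a^2
  + b^2), so it must be zero.\<close>

lemma harmonic_unit_gradient_imp_affine:
  fixes g :: "real ^ 2 \<Rightarrow> real"
  assumes g: "C2 g" and harmonic: "\<And>x. laplacian g x = 0"
    and unit: "\<And>x. (\<Sum>i\<in>UNIV. (partial i g x)\<^sup>2) = 1"
  obtains e a where "norm e = 1" "\<And>x. g x = x \<bullet> e + a"
proof -
  have eikonal: "(partial 1 g x)\<^sup>2 + (partial 2 g x)\<^sup>2 = 1" for x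
    using unit[of x] by (simp add: sum_2)
  have D: "partial 1 g x * partial j (partial 1 g) x + partial 2 g x * partial j (partial 2 g) x = 0" for j x
  proof -
    have "((\<lambda>t. (partial 1 g (x + t *\<^sub>R axis j 1))\<^sup>2 + (partial 2 g (x + t *\<^sub>R axis j 1))\<^sup>2) has_real_derivative
       2 * partial 1 g (x + 0 *\<^sub>R axis j 1) * partial j (partial 1 g) (x + 0 *\<^sub>R axis j 1)
       + 2 * partial 2 g (x + 0 *\<^sub>R axis j 1) * partial j (partial 2 g) (x + 0 *\<^sub>R axis j 1)) (at 0)"
      by (auto intro!: derivative_eq_intros has_real_derivative_line C2_differentiable[OF g])
    then have "((\<lambda>t. 1) has_real_derivative
       2 * partial 1 g x * partial j (partial 1 g) x + 2 * partial 2 g x * partial j (partial 2 g) x) (at (0 :: real))"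
      unfolding eikonal by simp
    from DERIV_unique[OF this DERIV_const] show ?thesis
      by simp
  qed
  have hess: "partial j (partial i g) x = 0" for i j x
  proof -
    define p q a b where "p = partial 1 g x" "q = partial 2 g x"
      "a = partial 1 (partial 1 g) x" "b = partial 2 (partial 1 g) x"
    have c: "partial 2 (partial 2 g) x = - a" "partial 1 (partial 2 g) x = b"
      using harmonic[of x] partial_commute[OF g, of 1 2 x] by (simp_all add: laplacian_def sum_2 p_q_a_b_def)
    have 1: "p\<^sup>2 + q\<^sup>2 = 1" "p * a + q * b = 0" "p * b - q * a = 0"
      using eikonal[of x] D[of x 1] D[of x 2] c by (simp_all add: p_q_a_b_def)
    \<comment> \<open>Cramer's rule for the two linear equations in a and b, whose determinant has
      absolute value p^2 + q^2 = 1.\<close>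
    have "(p\<^sup>2 + q\<^sup>2) * a = p * (p * a + q * b) - q * (p * b - q * a)"
      "(p\<^sup>2 + q\<^sup>2) * b = q * (p * a + q * b) + p * (p * b - q * a)"
      by (simp_all add: algebra_simps power2_eq_square)
    then have "a = 0" "b = 0"
      unfolding 1 by simp_all
    then have "partial 1 (partial 1 g) x = 0" "partial 2 (partial 1 g) x = 0"
      by (simp_all only: p_q_a_b_def)
    moreover have "partial 2 (partial 2 g) x = 0" "partial 1 (partial 2 g) x = 0"
      using c \<open>a = 0\<close> \<open>b = 0\<close> by simp_all
    ultimately have "\<forall>i j. partial j (partial i g) x = 0"
      unfolding forall_2 by blast
    then show ?thesis
      by blast
  qed
  define e where "e = (\<chi> i. partial i g 0)"
  have pg: "partial i g x = e $ i" for i x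
    by (simp add: e_def) (rule zero_gradient_imp_constant[OF C2_differentiable(2)[OF g] hess])
  have "(norm e)\<^sup>2 = 1"
    using unit[of 0] by (simp add: norm_power2_sum pg)
  then have "norm e = 1"
    by (simp add: power2_eq_1_iff) (smt (verit) norm_ge_zero)
  have const: "g x - x \<bullet> e = g 0 - 0 \<bullet> e" for x
    by (rule zero_gradient_imp_constant[where f = "\<lambda>x. g x - x \<bullet> e"])
      (simp_all add: partial_inner_diff C2_differentiable[OF g] pg)
  have "g x = x \<bullet> e + g 0" for x
    using const[of x] by (simp add: algebra_simps)
  with \<open>norm e = 1\<close> show ?thesis
    by (rule that)
qed

section \<open>Reduction of an ordered pair to a Riccati field\<close>

definition plane :: "real \<times> real \<Rightarrow> real ^ 2" where
  "plane p = fst p *\<^sub>R axis 1 1 + snd p *\<^sub>R axis 2 1"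

lemma plane_surj: "plane (x $ 1, x $ 2) = x"
  by (simp add: plane_def vec_eq_iff forall_2 axis_def)

lemma plane_deriv:
  assumes "\<And>x. f differentiable (at x)"
  shows "((\<lambda>s. f (plane (s, y))) has_real_derivative partial 1 f (plane (x, y))) (at x)"
    and "((\<lambda>s. f (plane (x, s))) has_real_derivative partial 2 f (plane (x, y))) (at y)"
  using has_real_derivative_line[OF assms, where x = "y *\<^sub>R axis 2 1" and t = x and i = 1]
    has_real_derivative_line[OF assms, where x = "x *\<^sub>R axis 1 1" and t = y and i = 2]
  by (simp_all add: plane_def add.commute)

lemma continuous_on_plane:
  assumes "continuous_on UNIV f"
  shows "continuous_on S (\<lambda>p. f (plane p))"
proof -
  have "continuous_on S plane"
    unfolding plane_def[abs_def] by (intro continuous_intros)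
  then show ?thesis
    by (rule continuous_on_compose2[OF assms]) simp
qed

text \<open>The weight \<rho> satisfies \<nabla>\<rho> = - sqrt 2 \<rho> (u1 \<nabla>g1 + u2
  \<nabla>g2), which cancels the squared gradients in the equation for d = g2 - g1. The field Y =
  \<rho> \<nabla>d / d then obeys the Riccati inequality and vanishes; the equality case gives both
  claims.\<close>

lemma ordered_layers:
  fixes g1 g2 u1 u2 :: "real ^ 2 \<Rightarrow> real"
  assumes u: "C2 u1" "C2 u2" and g: "C2 g1" "C2 g2"
    and abs_u: "\<And>x. \<bar>u1 x\<bar> < 1" "\<And>x. \<bar>u2 x\<bar> < 1"
    and less: "\<And>x. u1 x < u2 x" "\<And>x. g1 x < g2 x"
    and du: "\<And>i x. sqrt 2 * partial i u1 x = (1 - (u1 x)\<^sup>2) * partial i g1 x"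
      "\<And>i x. sqrt 2 * partial i u2 x = (1 - (u2 x)\<^sup>2) * partial i g2 x"
    and lap: "\<And>x. laplacian g1 x = sqrt 2 * u1 x * ((\<Sum>i\<in>UNIV. (partial i g1 x)\<^sup>2) - 1)"
      "\<And>x. laplacian g2 x = sqrt 2 * u2 x * ((\<Sum>i\<in>UNIV. (partial i g2 x)\<^sup>2) - 1)"
    and modica: "\<And>x. (\<Sum>i\<in>UNIV. (partial i g1 x)\<^sup>2) \<le> 1" "\<And>x. (\<Sum>i\<in>UNIV. (partial i g2 x)\<^sup>2) \<le> 1"
  shows "partial i g2 x = partial i g1 x" and "(\<Sum>i\<in>UNIV. (partial i g1 x)\<^sup>2) = 1"
proof -
  define \<rho> where "\<rho> = (\<lambda>x. (1 - (u1 x)\<^sup>2) * (1 - (u2 x)\<^sup>2))"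
  define d where "d = (\<lambda>x. g2 x - g1 x)"
  define w where "w = (\<lambda>i x. partial i g2 x - partial i g1 x)"
  define m where "m = (\<lambda>x. \<Sum>i\<in>UNIV. partial i g1 x * partial i g2 x)"
  define Y where "Y = (\<lambda>i x. \<rho> x * w i x / d x)"
  \<comment> \<open>The derivative of \<open>Y i\<close> along axis i, with the derivative of \<rho>
    already expressed through \<open>du\<close>.\<close>
  define Y' where "Y' = (\<lambda>i x. (\<rho> x * (partial i (partial i g2) x - partial i (partial i g1) x)
     - sqrt 2 * \<rho> x * (u1 x * partial i g1 x + u2 x * partial i g2 x) * w i x) / d x - \<rho> x * (w i x)\<^sup>2 / (d x)\<^sup>2)"
  have dpos: "d x > 0" for x
    using less by (simp add: d_def)
  have u2: "1 - (u1 x)\<^sup>2 > 0" "1 - (u2 x)\<^sup>2 > 0" for x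
    using abs_u[of x] by (simp_all add: abs_square_less_1)
  have \<rho>: "0 < \<rho> x" "\<rho> x \<le> 1" for x
    using u2[of x] by (simp_all add: \<rho>_def mult_le_one)
  have lapY: "Y' 1 x + Y' 2 x = (sqrt 2 * \<rho> x * (u2 x - u1 x) * (m x - 1)) / d x - \<rho> x * ((w 1 x)\<^sup>2 + (w 2 x)\<^sup>2) / (d x)\<^sup>2" for x
  proof -
    have "Y' 1 x + Y' 2 x = (\<rho> x * (laplacian g2 x - laplacian g1 x)
       - sqrt 2 * \<rho> x * (\<Sum>i\<in>UNIV. (u1 x * partial i g1 x + u2 x * partial i g2 x) * w i x)) / d x
       - \<rho> x * ((w 1 x)\<^sup>2 + (w 2 x)\<^sup>2) / (d x)\<^sup>2"
      by (simp add: Y'_def laplacian_def sum_2 add_divide_distrib[symmetric] diff_divide_distrib[symmetric] algebra_simps)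
    also have "\<rho> x * (laplacian g2 x - laplacian g1 x)
       - sqrt 2 * \<rho> x * (\<Sum>i\<in>UNIV. (u1 x * partial i g1 x + u2 x * partial i g2 x) * w i x)
       = sqrt 2 * \<rho> x * (u2 x - u1 x) * (m x - 1)"
      unfolding lap by (simp add: sum_2 w_def m_def power2_eq_square algebra_simps)
    finally show ?thesis .
  qed
  \<comment> \<open>Twice the inner product is at most the sum of the squared lengths, each at most
    one by Modica's inequality.\<close>
  have m1: "m x \<le> 1" for x
  proof -
    have "2 * m x \<le> (\<Sum>i\<in>UNIV. (partial i g1 x)\<^sup>2) + (\<Sum>i\<in>UNIV. (partial i g2 x)\<^sup>2)"
      unfolding m_def sum_distrib_left sum.distrib[symmetric]
      by (intro sum_mono) (metis mult.assoc sum_squares_bound)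
    with modica[of x] show ?thesis
      by linarith
  qed
  have Y0: "Y' 1 x + Y' 2 x + (Y 1 x)\<^sup>2 + (Y 2 x)\<^sup>2 \<le> 0" for x
  proof -
    have "sqrt 2 * \<rho> x * (u2 x - u1 x) * (m x - 1) \<le> 0"
      using \<rho>[of x] less(1)[of x] m1[of x] by (intro mult_nonneg_nonpos) auto
    then have "(sqrt 2 * \<rho> x * (u2 x - u1 x) * (m x - 1)) / d x \<le> 0"
      using dpos[of x] by (simp add: divide_nonpos_pos)
    \<comment> \<open>Because \<rho> \<le> 1, the last term of \<open>lapY\<close> absorbs |Y|^2,
      which carries \<rho>^2 in place of \<rho>.\<close>
    moreover have "(\<rho> x)\<^sup>2 \<le> \<rho> x"
      using \<rho>[of x] by (simp add: power2_eq_square mult_left_le)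
    then have "(\<rho> x)\<^sup>2 * ((w 1 x)\<^sup>2 + (w 2 x)\<^sup>2) / (d x)\<^sup>2 \<le> \<rho> x * ((w 1 x)\<^sup>2 + (w 2 x)\<^sup>2) / (d x)\<^sup>2"
      by (intro divide_right_mono mult_right_mono) auto
    moreover have "(Y 1 x)\<^sup>2 + (Y 2 x)\<^sup>2 = (\<rho> x)\<^sup>2 * ((w 1 x)\<^sup>2 + (w 2 x)\<^sup>2) / (d x)\<^sup>2"
      by (simp add: Y_def power_mult_distrib power_divide add_divide_distrib[symmetric] algebra_simps)
    ultimately show ?thesis
      unfolding lapY by linarith
  qed
  \<comment> \<open>Stated for arbitrary functions of one variable with matching data at t, so that
    one computation serves both coordinate directions.\<close>
  have quot: "((\<lambda>s. (1 - (U1 s)\<^sup>2) * (1 - (U2 s)\<^sup>2) * (W2 s - W1 s) / (G2 s - G1 s)) has_real_derivative Y' i x) (at t)"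
    if "(U1 has_real_derivative partial i u1 x) (at t)" "(U2 has_real_derivative partial i u2 x) (at t)"
      "(G1 has_real_derivative partial i g1 x) (at t)" "(G2 has_real_derivative partial i g2 x) (at t)"
      "(W1 has_real_derivative partial i (partial i g1) x) (at t)"
      "(W2 has_real_derivative partial i (partial i g2) x) (at t)"
      "U1 t = u1 x" "U2 t = u2 x" "G1 t = g1 x" "G2 t = g2 x" "W1 t = partial i g1 x" "W2 t = partial i g2 x"
    for U1 U2 G1 G2 W1 W2 :: "real \<Rightarrow> real" and i x t
  proof -
    have sqrt2: "sqrt 2 * a * (sqrt 2 * b) = 2 * a * b" for a b
    proof -
      have "sqrt 2 * a * (sqrt 2 * b) = (sqrt 2 * sqrt 2) * (a * b)"
        by (simp only: mult_ac)
      then show ?thesis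
        by simp
    qed
    have "2 * u1 x * partial i u1 x * (1 - (u2 x)\<^sup>2) + (1 - (u1 x)\<^sup>2) * (2 * u2 x * partial i u2 x)
       = sqrt 2 * u1 x * (sqrt 2 * partial i u1 x) * (1 - (u2 x)\<^sup>2) + (1 - (u1 x)\<^sup>2) * (sqrt 2 * u2 x * (sqrt 2 * partial i u2 x))"
      by (simp only: sqrt2)
    also have "\<dots> = sqrt 2 * \<rho> x * (u1 x * partial i g1 x + u2 x * partial i g2 x)"
      unfolding du by (simp add: \<rho>_def algebra_simps)
    finally have \<rho>': "2 * u1 x * partial i u1 x * (1 - (u2 x)\<^sup>2) + (1 - (u1 x)\<^sup>2) * (2 * u2 x * partial i u2 x)
       = sqrt 2 * \<rho> x * (u1 x * partial i g1 x + u2 x * partial i g2 x)" .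
    have "((\<lambda>s. (1 - (U1 s)\<^sup>2) * (1 - (U2 s)\<^sup>2)) has_real_derivative
        - (2 * u1 x * partial i u1 x * (1 - (u2 x)\<^sup>2) + (1 - (u1 x)\<^sup>2) * (2 * u2 x * partial i u2 x))) (at t)"
      by (rule derivative_eq_intros that refl)+ (simp add: that algebra_simps)
    then have R: "((\<lambda>s. (1 - (U1 s)\<^sup>2) * (1 - (U2 s)\<^sup>2)) has_real_derivative
        - (sqrt 2 * \<rho> x * (u1 x * partial i g1 x + u2 x * partial i g2 x))) (at t)"
      unfolding \<rho>' .
    have "G2 t - G1 t \<noteq> 0"
      using dpos[of x] that by (simp add: d_def)
    from DERIV_divide[OF DERIV_mult[OF R DERIV_diff[OF that(6,5)]] DERIV_diff[OF that(4,3)] this]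
    have D: "((\<lambda>s. (1 - (U1 s)\<^sup>2) * (1 - (U2 s)\<^sup>2) * (W2 s - W1 s) / (G2 s - G1 s)) has_real_derivative
      ((- (sqrt 2 * \<rho> x * (u1 x * partial i g1 x + u2 x * partial i g2 x)) * w i x + (partial i (partial i g2) x - partial i (partial i g1) x) * \<rho> x) * d x
        - \<rho> x * w i x * w i x) / (d x * d x)) (at t)"
      by (simp add: that \<rho>_def w_def d_def)
    have "((- K * v + W * r) * c - r * v * v) / (c * c) = (r * W - K * v) / c - r * v\<^sup>2 / c\<^sup>2"
      if "c > 0" for K v W r c :: real
      using that by (simp add: field_simps power2_eq_square)
    from D[unfolded this[OF dpos]] show ?thesis
      unfolding Y'_def .
  qed
  note diff = C2_differentiable[OF u(1)] C2_differentiable[OF u(2)] C2_differentiable[OF g(1)] C2_differentiable[OF g(2)]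
  have nz: "g2 x - g1 x \<noteq> 0" for x
    using less(2)[of x] by simp
  have cY: "continuous_on UNIV (Y i)" "continuous_on UNIV (Y' i)" for i
    unfolding Y_def Y'_def \<rho>_def w_def d_def
    by (intro continuous_intros C2_continuous[OF u(1)] C2_continuous[OF u(2)]
        C2_continuous[OF g(1)] C2_continuous[OF g(2)] ballI nz power_not_zero)+
  have Y_eq: "Y i x = (1 - (u1 x)\<^sup>2) * (1 - (u2 x)\<^sup>2) * (partial i g2 x - partial i g1 x) / (g2 x - g1 x)" for i x
    by (simp add: Y_def \<rho>_def w_def d_def)
  \<comment> \<open>Composition with \<open>plane\<close> carries the field to the product type, on
    which the rectangle integrals are formed.\<close>
  interpret plane_riccati "\<lambda>p. Y 1 (plane p)" "\<lambda>p. Y' 1 (plane p)" "\<lambda>p. Y 2 (plane p)" "\<lambda>p. Y' 2 (plane p)"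
  proof
    show "((\<lambda>s. Y 1 (plane (s, y))) has_real_derivative Y' 1 (plane (x, y))) (at x)" for x y
      unfolding Y_eq
      by (rule quot) (rule plane_deriv diff refl)+
    show "((\<lambda>s. Y 2 (plane (x, s))) has_real_derivative Y' 2 (plane (x, y))) (at y)" for x y
      unfolding Y_eq by (rule quot) (rule plane_deriv diff refl)+
  qed (rule continuous_on_plane cY Y0)+
  have Yz: "Y 1 x = 0" "Y 2 x = 0" for x
    using vanishes[of "(x $ 1, x $ 2)"] by (simp_all add: plane_surj)
  \<comment> \<open>Since Y vanishes identically, so does its divergence; with w = 0,
    \<open>lapY\<close> leaves only the term with the factor m - 1 and forces m = 1.\<close>
  have Y'z: "Y' 1 x = 0" "Y' 2 x = 0" for x
    using P_deriv[of "x $ 2" "x $ 1"] Q_deriv[of "x $ 1" "x $ 2"] unfolding Yz plane_surj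
    by (auto dest: DERIV_unique[OF _ DERIV_const])
  have wz: "w i x = 0" for i x
  proof -
    have "w 1 x = 0" "w 2 x = 0"
      using Yz[of x] \<rho>(1)[of x] dpos[of x] by (simp_all add: Y_def)
    then show ?thesis
      using exhaust_2[of i] by metis
  qed
  then show eq: "partial i g2 x = partial i g1 x" for i x
    by (simp add: w_def)
  have "sqrt 2 * \<rho> x * (u2 x - u1 x) * (m x - 1) = 0"
    using lapY[of x] Y'z[of x] dpos[of x] by (simp add: wz)
  then have "m x = 1"
    using \<rho>[of x] less(1)[of x] by simp
  then show "(\<Sum>i\<in>UNIV. (partial i g1 x)\<^sup>2) = 1"
    by (simp add: m_def eq power2_eq_square)
qed

theorem corollary2:
  fixes u1 u2 :: "real ^ 2 \<Rightarrow> real"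
  assumes "allen_cahn_classical_solution u1" and "allen_cahn_classical_solution u2"
    and "\<not> u1 constant_on UNIV" and "\<not> u2 constant_on UNIV"
    and "\<And>x. u1 x < u2 x"
  shows "\<exists>(e :: real ^ 2) (a :: real) (b :: real). norm e = 1 \<and> a < b \<and>
           (\<forall>x. u1 x = H (x \<bullet> e + a)) \<and> (\<forall>x. u2 x = H (x \<bullet> e + b))"
proof -
  define g where "g = (\<lambda>u (x :: real ^ 2). layer_inv 1 (u x))"
  have facts: "C2 u" "C2 (g u)" "\<bar>u x\<bar> < 1"
    "sqrt 2 * partial i u x = (1 - (u x)\<^sup>2) * partial i (g u) x"
    "laplacian (g u) x = sqrt 2 * u x * ((\<Sum>i\<in>UNIV. (partial i (g u) x)\<^sup>2) - 1)"
    "(\<Sum>i\<in>UNIV. (partial i (g u) x)\<^sup>2) \<le> 1" "H (g u x) = u x"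
    if u: "allen_cahn_classical_solution u" "\<not> u constant_on UNIV" for u i x
  proof -
    show "C2 u"
      using u by (simp add: allen_cahn_classical_solution_def)
    note lt = allen_cahn_abs_less_1[OF u]
    note * = allen_cahn_layer_inv[OF u(1) lt]
    show "C2 (g u)" "\<bar>u x\<bar> < 1" "(\<Sum>i\<in>UNIV. (partial i (g u) x)\<^sup>2) \<le> 1" "H (g u x) = u x"
      using *(1) lt allen_cahn_modica[OF u] H_layer_inv[OF lt] by (auto simp: g_def)
    have "1 - (u x)\<^sup>2 > 0"
      using lt[of x] by (simp add: abs_square_less_1)
    then show "sqrt 2 * partial i u x = (1 - (u x)\<^sup>2) * partial i (g u) x"
      unfolding g_def *(2) by simp
    show "laplacian (g u) x = sqrt 2 * u x * ((\<Sum>i\<in>UNIV. (partial i (g u) x)\<^sup>2) - 1)"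
      unfolding g_def *(3) by simp
  qed
  note f1 = facts[OF assms(1,3)] and f2 = facts[OF assms(2,4)]
  have less: "g u1 x < g u2 x" for x
  proof -
    have "g u1 x \<le> g u2 x"
      unfolding g_def using assms(5)[of x] f1(3) f2(3) by (intro layer_inv_mono) auto
    moreover have "g u1 x \<noteq> g u2 x"
      using f1(7)[of x] f2(7)[of x] assms(5)[of x] by auto
    ultimately show ?thesis
      by simp
  qed
  note layers = ordered_layers[OF f1(1) f2(1) f1(2) f2(2) f1(3) f2(3) assms(5) less f1(4) f2(4) f1(5) f2(5) f1(6) f2(6)]
  \<comment> \<open>The right-hand side of the equation for g u1 has the factor |\<nabla>g|^2 - 1,
    which is now zero.\<close>
  have "laplacian (g u1) x = 0" for x
    using f1(5)[of x] layers(2)[of x] by simp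
  from harmonic_unit_gradient_imp_affine[OF f1(2) this layers(2)]
  obtain e a where e: "norm e = 1" "\<And>x. g u1 x = x \<bullet> e + a"
    by blast
  have pe: "partial i (g u1) x = e $ i" for i x
  proof -
    have "((\<lambda>x. x \<bullet> e + a) has_derivative (\<lambda>h. h \<bullet> e)) (at x)"
      by (auto intro!: derivative_eq_intros)
    moreover have "g u1 = (\<lambda>x. x \<bullet> e + a)"
      using e(2) by (rule ext)
    ultimately show ?thesis
      using partial_eq[of "g u1" "\<lambda>h. h \<bullet> e" x i] by (simp add: inner_axis')
  qed
  \<comment> \<open>Both layers share the gradient e, so g u2 is the same linear function up to its
    value at the origin, which serves as b.\<close>
  have const: "g u2 x - x \<bullet> e = g u2 0 - 0 \<bullet> e" for x
    by (rule zero_gradient_imp_constant[where f = "\<lambda>x. g u2 x - x \<bullet> e"])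
      (simp_all add: partial_inner_diff C2_differentiable[OF f2(2)] layers(1) pe)
  have g2: "g u2 x = x \<bullet> e + g u2 0" for x
    using const[of x] by (simp add: algebra_simps)
  have "a < g u2 0"
    using less[of 0] e(2)[of 0] by simp
  moreover have "u1 x = H (x \<bullet> e + a)" "u2 x = H (x \<bullet> e + g u2 0)" for x
    using f1(7)[of x] f2(7)[of x] e(2)[of x] g2[of x] by simp_all
  ultimately show ?thesis
    using e(1) by blast
qed

end
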